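(* $\mathbf{ResS}$ is stronger than $\mathbf{Res}$: $\mathbf{ResS}$ p-simulates $\mathbf{Res}$, but $\mathbf{Res}$ does not p-simulate $\mathbf{ResS}$.
   Context: A literal is a Boolean variable $x$ or its negation $\overline x$; a clause is a disjunction of literals ($\Box$ is the empty clause). Weights are elements of $\mathbb{R}_{>0}\cup\{\infty\}$ with $\infty+w=\infty-w=\infty$. A MaxSAT formula is a finite collection of weighted clauses $(C,w)$, where $(C,u),(C,v)$ may be merged into $(C,u+v)$ and conversely, and clauses of weight $0$ disappear. The cost $\mathcal F(X)$ of a truth assignment $X$ is the sum of weights of clauses falsified by $X$, and $\mathrm{MaxSAT}(\mathcal F)=\min_X\mathcal F(X)$. $\mathcal G\subseteq\mathcal F$ means every $(C,w)\in\mathcal G$ has some $(C,w')\in\mathcal F$ with $w\le w'$. A MaxSAT inference rule replaces its antecedents in the current formula by its consequents. A proof in a proof system $\Delta$ is a sequence $\mathcal F_0;\dots;\mathcal F_e$ (length $e$), each obtained from the previous by one rule application; $\mathcal F\vdash_\Delta\mathcal G$ means there is such a proof with $\mathcal F_0=\mathcal F$, $\mathcal G\subseteq\mathcal F_e$ and all weights in $\mathcal F_e$ positive. A refutation of $\mathcal F$ is a proof $\mathcal F\vdash_\Delta\{(\Box,\mathrm{MaxSAT}(\mathcal F))\}$. Rules: Resolution: from $(x\lor A,v),(\overline x\lor B,w)$ ($A,B$ possibly empty disjunctions), with $m=\min\{v,w\}$, derive $(A\lor B,m),(x\lor A,v-m),(\overline x\lor B,w-m),(x\lor A\lor\overline B,m),(\overline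 x\lor B\lor\overline A,m)$, where for $D=l_1\lor\dots\lor l_p$ the expression $(E\lor\overline D,u)$ stands for $(E\lor\overline{l_1},u),(E\lor l_1\lor\overline{l_2},u),\dots,(E\lor l_1\lor\dots\lor l_{p-1}\lor\overline{l_p},u)$ (nothing if $D$ is empty), and tautologies are discarded. Split: from $(A,w)$ derive $(A\lor x,w),(A\lor\overline x,w)$. $\mathbf{Res}=\{\text{resolution}\}$, $\mathbf{ResS}=\{\text{resolution},\text{split}\}$. A proof system $\Delta$ p-simulates $\Gamma$ if there is a polynomial-time computable function transforming every $\Gamma$-refutation of a formula into a $\Delta$-refutation of the same formula; $\Delta$ is stronger than $\Gamma$ if $\Delta$ p-simulates $\Gamma$ and $\Gamma$ does not p-simulate $\Delta$. *)

theory Defs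
  imports "HOL-Library.Extended_Nonnegative_Real" "HOL-Computational_Algebra.Polynomial"
begin

section \<open>Weighted clauses\<close>

datatype literal = Pos nat | Neg nat

fun compl :: "literal \<Rightarrow> literal" where
  "compl (Pos x) = Neg x"
| "compl (Neg x) = Pos x"

type_synonym clause = "literal set"

definition tautology :: "clause \<Rightarrow> bool" where
  "tautology C \<longleftrightarrow> (\<exists>x. Pos x \<in> C \<and> Neg x \<in> C)"

type_synonym assignment = "nat \<Rightarrow> bool"

fun lit_true :: "assignment \<Rightarrow> literal \<Rightarrow> bool" where
  "lit_true X (Pos x) \<longleftrightarrow> X x"
| "lit_true X (Neg x) \<longleftrightarrow> \<not> X x"

definition falsifies :: "assignment \<Rightarrow> clause \<Rightarrow> bool" where
  "falsifies X C \<longleftrightarrow> (\<forall>l\<in>C. \<not> lit_true X l)"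

text \<open>
  Collections of weighted clauses are considered up to merging and unmerging equal clauses and
  up to clauses of weight 0. Such a collection is the function sending each clause to the total
  weight it carries, and 0 means that the clause does not occur; in particular all occurring
  weights are positive. Subtraction on \<^typ>\<open>ennreal\<close> satisfies \<open>\<infinity> - w = \<infinity>\<close>, also for \<open>w = \<infinity>\<close>.
\<close>

type_synonym wformula = "clause \<Rightarrow> ennreal"

definition is_formula :: "wformula \<Rightarrow> bool" where
  "is_formula F \<longleftrightarrow> finite {C. F C \<noteq> 0} \<and> (\<forall>C. F C \<noteq> 0 \<longrightarrow> finite C)"

definition formula_of :: "(clause \<times> ennreal) list \<Rightarrow> wformula" where
  "formula_of ws = (\<lambda>C. \<Sum>(D, w)\<leftarrow>ws. if D = C then w else 0)"

definition cost :: "wformula \<Rightarrow> assignment \<Rightarrow> ennreal" where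
  "cost F X = (\<Sum>C | F C \<noteq> 0 \<and> falsifies X C. F C)"

text \<open>A formula has finitely many variables, so the infimum is attained.\<close>

definition MaxSAT :: "wformula \<Rightarrow> ennreal" where
  "MaxSAT F = (INF X. cost F X)"

definition subformula :: "wformula \<Rightarrow> wformula \<Rightarrow> bool" where
  "subformula G F \<longleftrightarrow> (\<forall>C. G C \<le> F C)"


section \<open>Rules, proofs and refutations\<close>

text \<open>A rule relates the collection of its antecedents to the collection of its consequents.\<close>

type_synonym rule = "wformula \<Rightarrow> wformula \<Rightarrow> bool"
type_synonym proof_system = "rule set"

text \<open>\<open>or_not E D\<close> lists the clauses abbreviated by \<open>E \<or> \<not> D\<close>.\<close>

fun or_not :: "clause \<Rightarrow> literal list \<Rightarrow> clause list" where
  "or_not E [] = []"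
| "or_not E (l # D) = insert (compl l) E # or_not (insert l E) D"

definition discard_tautologies :: "(clause \<times> ennreal) list \<Rightarrow> (clause \<times> ennreal) list" where
  "discard_tautologies ws = filter (\<lambda>(C, w). \<not> tautology C) ws"

text \<open>
  The side conditions \<open>Pos x \<notin> set A\<close> and \<open>Neg x \<notin> set B\<close> say that \<open>A\<close> and \<open>B\<close> are what remains of
  the antecedents once the clashing literals are taken away; without them the rule would yield
  weakenings of its antecedents.
\<close>

inductive resolution :: rule where
  "\<lbrakk>distinct A; distinct B; Pos x \<notin> set A; Neg x \<notin> set B; 0 < v; 0 < w; m = min v w;
    xA = insert (Pos x) (set A); xB = insert (Neg x) (set B)\<rbrakk> \<Longrightarrow>
   resolution
     (formula_of [(xA, v), (xB, w)])
     (formula_of (discard_tautologies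
       ([(set A \<union> set B, m), (xA, v - m), (xB, w - m)]
        @ map (\<lambda>C. (C, m)) (or_not xA B)
        @ map (\<lambda>C. (C, m)) (or_not xB A))))"

inductive split :: rule where
  "\<lbrakk>finite A; 0 < w\<rbrakk> \<Longrightarrow>
   split
     (formula_of [(A, w)])
     (formula_of (discard_tautologies [(insert (Pos x) A, w), (insert (Neg x) A, w)]))"

definition Res :: proof_system where
  "Res = {resolution}"

definition ResS :: proof_system where
  "ResS = {resolution, split}"

text \<open>
  The antecedents \<open>P\<close> are replaced by the consequents \<open>Q\<close>, and \<open>R\<close> is the untouched rest. A clause
  of weight \<open>\<infinity>\<close> used with weight \<open>\<infinity>\<close> may stay in \<open>R\<close> with any weight, since it can be unmerged first.
\<close>

definition step :: "proof_system \<Rightarrow> wformula \<Rightarrow> wformula \<Rightarrow> bool" where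
  "step \<Delta> F F' \<longleftrightarrow> (\<exists>r\<in>\<Delta>. \<exists>P Q R. r P Q \<and> F = (\<lambda>C. R C + P C) \<and> F' = (\<lambda>C. R C + Q C))"

definition is_proof :: "proof_system \<Rightarrow> wformula list \<Rightarrow> bool" where
  "is_proof \<Delta> \<pi> \<longleftrightarrow> \<pi> \<noteq> [] \<and> (\<forall>i. Suc i < length \<pi> \<longrightarrow> step \<Delta> (\<pi> ! i) (\<pi> ! Suc i))"

definition proof_of :: "proof_system \<Rightarrow> wformula \<Rightarrow> wformula \<Rightarrow> wformula list \<Rightarrow> bool" where
  "proof_of \<Delta> F G \<pi> \<longleftrightarrow> is_proof \<Delta> \<pi> \<and> hd \<pi> = F \<and> subformula G (last \<pi>)"

definition refutation :: "proof_system \<Rightarrow> wformula \<Rightarrow> wformula list \<Rightarrow> bool" where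
  "refutation \<Delta> F \<pi> \<longleftrightarrow> proof_of \<Delta> F (formula_of [({}, MaxSAT F)]) \<pi>"


section \<open>Proofs as words\<close>

datatype sym = Bit bool | Slash | PosMark | NegMark | Colon | Comma | Semicolon

type_synonym word = "sym list"

text \<open>Binary numerals, most significant bit first, with the empty word for 0.\<close>

fun bin :: "nat \<Rightarrow> word" where
  "bin n = (if n = 0 then [] else bin (n div 2) @ [Bit (odd n)])"

declare bin.simps [simp del]

text \<open>
  No system of finite names covers all real weights at once, so words are read relative to a
  notation: a partial map from names to weights. Positive rationals are named by binary fractions
  and \<open>\<infinity>\<close> by a single slash, and all remaining names are free to denote arbitrary further positive
  reals. Hence the weights of any given proof are all named by some notation.
\<close>

type_synonym notation_map = "word \<Rightarrow> ennreal option"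

definition weight_notation :: "notation_map \<Rightarrow> bool" where
  "weight_notation \<nu> \<longleftrightarrow>
     dom \<nu> \<subseteq> lists (range Bit \<union> {Slash}) \<and>
     ran \<nu> \<subseteq> {0<..} \<and>
     (\<forall>p q. 0 < p \<longrightarrow> 0 < q \<longrightarrow> \<nu> (bin p @ [Slash] @ bin q) = Some (ennreal (real p / real q))) \<and>
     \<nu> [Slash] = Some \<infinity>"

fun lit_word :: "literal \<Rightarrow> word" where
  "lit_word (Pos x) = PosMark # bin x"
| "lit_word (Neg x) = NegMark # bin x"

text \<open>A written formula is a list of pairs of a written clause and the name of its weight.\<close>

type_synonym written_formula = "(literal list \<times> word) list"

definition formula_word :: "written_formula \<Rightarrow> word" where
  "formula_word fs = concat (map (\<lambda>(ls, a). concat (map lit_word ls) @ [Colon] @ a @ [Comma]) fs)"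

definition proof_word :: "written_formula list \<Rightarrow> word" where
  "proof_word p = concat (map (\<lambda>fs. formula_word fs @ [Semicolon]) p)"

definition denotes :: "notation_map \<Rightarrow> written_formula \<Rightarrow> wformula \<Rightarrow> bool" where
  "denotes \<nu> fs F \<longleftrightarrow>
     (\<forall>(ls, a)\<in>set fs. a \<in> dom \<nu>) \<and> F = formula_of (map (\<lambda>(ls, a). (set ls, the (\<nu> a))) fs)"

definition encodes :: "notation_map \<Rightarrow> word \<Rightarrow> wformula list \<Rightarrow> bool" where
  "encodes \<nu> s \<pi> \<longleftrightarrow> (\<exists>p. s = proof_word p \<and> list_all2 (denotes \<nu>) p \<pi>)"


section \<open>Polynomial time\<close>

text \<open>
  Deterministic Turing machines with one two-way infinite tape. The control states are the numbers
  below \<open>states M\<close>, the initial state is 0, and the machine halts on reaching any number that is at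
  least \<open>states M\<close>. Tape symbols are the numbers below \<open>symbols M\<close>, with 0 as the blank.
\<close>

datatype move = MoveLeft | Stay | MoveRight

record machine =
  states :: nat
  symbols :: nat
  delta :: "nat \<Rightarrow> nat \<Rightarrow> nat \<times> nat \<times> move"

fun sym_code :: "sym \<Rightarrow> nat" where
  "sym_code (Bit b) = (if b then 2 else 1)"
| "sym_code Slash = 3"
| "sym_code PosMark = 4"
| "sym_code NegMark = 5"
| "sym_code Colon = 6"
| "sym_code Comma = 7"
| "sym_code Semicolon = 8"

definition is_machine :: "machine \<Rightarrow> bool" where
  "is_machine M \<longleftrightarrow>
     (\<forall>a. sym_code a < symbols M) \<and>
     (\<forall>q < states M. \<forall>a < symbols M. fst (snd (delta M q a)) < symbols M)"

type_synonym config = "nat \<times> (int \<Rightarrow> nat) \<times> int"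

fun shift :: "move \<Rightarrow> int" where
  "shift MoveLeft = -1"
| "shift Stay = 0"
| "shift MoveRight = 1"

fun machine_step :: "machine \<Rightarrow> config \<Rightarrow> config" where
  "machine_step M (q, t, h) =
     (if q < states M
      then (case delta M q (t h) of (q', a, d) \<Rightarrow> (q', t(h := a), h + shift d))
      else (q, t, h))"

definition initial :: "word \<Rightarrow> config" where
  "initial s = (0, (\<lambda>i. if 0 \<le> i \<and> nat i < length s then sym_code (s ! nat i) else 0), 0)"

text \<open>The output is read from cell 0 up to the first blank.\<close>

fun halted_with :: "machine \<Rightarrow> config \<Rightarrow> word \<Rightarrow> bool" where
  "halted_with M (q, t, h) s \<longleftrightarrow>
     states M \<le> q \<and> (\<forall>i < length s. t (int i) = sym_code (s ! i)) \<and> t (int (length s)) = 0"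

definition polytime :: "(word \<Rightarrow> word) \<Rightarrow> bool" where
  "polytime f \<longleftrightarrow>
     (\<exists>M (p :: nat poly). is_machine M \<and>
        (\<forall>s. \<exists>n \<le> poly p (length s). halted_with M ((machine_step M ^^ n) (initial s)) (f s)))"


section \<open>Simulation\<close>

definition p_simulates :: "notation_map \<Rightarrow> proof_system \<Rightarrow> proof_system \<Rightarrow> bool" where
  "p_simulates \<nu> \<Delta> \<Gamma> \<longleftrightarrow>
     (\<exists>f. polytime f \<and>
        (\<forall>F \<pi> s. is_formula F \<longrightarrow> refutation \<Gamma> F \<pi> \<longrightarrow> encodes \<nu> s \<pi> \<longrightarrow>
           (\<exists>\<pi>'. refutation \<Delta> F \<pi>' \<and> encodes \<nu> (f s) \<pi>')))"

definition stronger :: "notation_map \<Rightarrow> proof_system \<Rightarrow> proof_system \<Rightarrow> bool" where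
  "stronger \<nu> \<Delta> \<Gamma> \<longleftrightarrow> p_simulates \<nu> \<Delta> \<Gamma> \<and> \<not> p_simulates \<nu> \<Gamma> \<Delta>"

end

theory Submission
  imports Defs "HOL-Library.Multiset" "HOL-Library.Nat_Bijection"
begin

text \<open>
  The separating formulas state, with unit weights, that \<open>m + 1\<close> pigeons fit into \<open>m\<close> holes, and
  contain in addition \<open>m\<close> copies of the empty clause. Resolution can do nothing with these copies, so
  it has to refute the pigeonhole principle, and the exponential lower bound of Haken applies in the
  form given by Beame and Pitassi: a partial matching, found greedily, satisfies all wide clauses of
  a short refutation, but every refutation of the remaining pigeonhole principle has a wide clause.

  The split rule, in contrast, distributes each copy of the empty clause over the possible first
  pigeons of a hole. Together with the hole axioms this gives all unit clauses \<open>\<not> x\<^sub>i\<^sub>j\<close>. Distributed over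
  the possible first holes of each pigeon and merged with the pigeon axioms, they yield \<open>m + 1\<close>
  copies of the empty clause. Splitting and merging clauses are inverse to each other, so the
  refutation only has to be found up to the equivalence generated by splits.
\<close>

section \<open>Output length of polynomial-time functions\<close>

lemma sym_code_nonzero [simp]: "sym_code a \<noteq> 0"
  by (cases a) auto

text \<open>The head moves right by at most one cell per step, so \<open>n\<close> steps write only
  to cells below \<open>n\<close>; every other nonblank cell belongs to the input.\<close>

lemma machine_steps_tape:
  assumes "(machine_step M ^^ n) (initial s) = (q, t, h)"
  shows "h \<le> int n \<and> (\<forall>i. t i \<noteq> 0 \<longrightarrow> i < int (length s) \<or> i < int n)"
  using assms
proof (induction n arbitrary: q t h)
  case 0
  then show ?case by (auto simp: initial_def split: if_splits)
next
  case (Suc n)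
  obtain q0 t0 h0 where c: "(machine_step M ^^ n) (initial s) = (q0, t0, h0)"
    by (metis prod_cases3)
  have IH: "h0 \<le> int n" "\<And>i. t0 i \<noteq> 0 \<Longrightarrow> i < int (length s) \<or> i < int n"
    using Suc.IH[OF c] by auto
  have st: "machine_step M (q0, t0, h0) = (q, t, h)"
    using Suc.prems c by simp
  show ?case
  proof (cases "q0 < states M")
    case True
    obtain q' a d where d: "delta M q0 (t0 h0) = (q', a, d)"
      by (metis prod_cases3)
    have "t = t0(h0 := a)" "h = h0 + shift d"
      using st True d by auto
    moreover have "shift d \<le> 1"
      by (cases d) auto
    ultimately show ?thesis
      using IH by fastforce
  next
    case False
    then show ?thesis
      using st IH by fastforce
  qed
qed

text \<open>Codes of symbols are nonzero, so the last output cell is nonblank and thus lies in the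
  input or in the range reached by the head. This is the only consequence of polynomial time that
  the separation needs.\<close>

lemma polytime_length_bound:
  assumes "polytime f"
  obtains p :: "nat poly" where "\<And>s. length (f s) \<le> length s + poly p (length s)"
proof -
  obtain M and p :: "nat poly" where
    p: "\<And>s. \<exists>n \<le> poly p (length s). halted_with M ((machine_step M ^^ n) (initial s)) (f s)"
    using assms unfolding polytime_def by blast
  have "length (f s) \<le> length s + poly p (length s)" for s
  proof -
    obtain n where n: "n \<le> poly p (length s)"
      and h: "halted_with M ((machine_step M ^^ n) (initial s)) (f s)"
      using p by blast
    obtain q t k where c: "(machine_step M ^^ n) (initial s) = (q, t, k)"
      by (metis prod_cases3)
    show ?thesis
    proof (cases "length (f s)")
      case (Suc l)
      then have "t (int l) = sym_code (f s ! l)"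
        using h c by auto
      then have "t (int l) \<noteq> 0"
        by simp
      then have "int l < int (length s) \<or> int l < int n"
        using machine_steps_tape[OF c] by blast
      then show ?thesis
        using Suc n by linarith
    qed simp
  qed
  then show ?thesis
    using that by blast
qed

lemma polytime_id: "polytime (\<lambda>s. s)"
proof -
  \<comment> \<open>Without control states the initial state already counts as halted, so the input
    is left on the tape as output.\<close>
  let ?M = "\<lparr>states = 0, symbols = 9, delta = (\<lambda>_ _. (0, 0, Stay))\<rparr>"
  have "sym_code a < 9" for a
    by (cases a) auto
  then have "is_machine ?M"
    by (simp add: is_machine_def)
  moreover have "halted_with ?M ((machine_step ?M ^^ 0) (initial s)) s" for s
    by (simp add: initial_def)
  ultimately show ?thesis
    unfolding polytime_def by (intro exI[of _ ?M] exI[of _ 0]) auto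
qed

text \<open>With base \<open>x + 1\<close> in place of \<open>x\<close>, powers grow with the
  exponent even at \<open>x = 0\<close>, and the sum of the coefficients serves as constant.\<close>

lemma nat_poly_bound: "\<exists>c. \<forall>x. poly p x \<le> c * (x + 1) ^ degree p" for p :: "nat poly"
proof -
  have "poly p x \<le> (\<Sum>i\<le>degree p. coeff p i) * (x + 1) ^ degree p" for x
  proof -
    have "coeff p i * x ^ i \<le> coeff p i * (x + 1) ^ degree p" if "i \<le> degree p" for i
    proof -
      have "x ^ i \<le> (x + 1) ^ i" by (simp add: power_mono)
      also have "\<dots> \<le> (x + 1) ^ degree p" using that by (simp add: power_increasing)
      finally show ?thesis by simp
    qed
    then show ?thesis
      unfolding poly_altdef sum_distrib_right by (intro sum_mono) auto
  qed
  then show ?thesis by blast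
qed


section \<open>The lower bound for resolution\<close>

abbreviation pvar :: "nat \<Rightarrow> nat \<Rightarrow> nat" where
  "pvar i j \<equiv> prod_encode (i, j)"

definition matching :: "nat \<Rightarrow> (nat \<times> nat) set \<Rightarrow> bool" where
  "matching m \<rho> \<longleftrightarrow> \<rho> \<subseteq> {..m} \<times> {..<m} \<and> inj_on fst \<rho> \<and> inj_on snd \<rho>"

definition free_pigeons :: "nat \<Rightarrow> (nat \<times> nat) set \<Rightarrow> nat set" where
  "free_pigeons m \<rho> = {..m} - fst ` \<rho>"

definition free_holes :: "nat \<Rightarrow> (nat \<times> nat) set \<Rightarrow> nat set" where
  "free_holes m \<rho> = {..<m} - snd ` \<rho>"

definition critical :: "nat \<Rightarrow> (nat \<times> nat) set \<Rightarrow> nat \<Rightarrow> (nat \<Rightarrow> nat) \<Rightarrow> bool" where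
  "critical m \<rho> i \<alpha> \<longleftrightarrow>
     i \<in> free_pigeons m \<rho> \<and> bij_betw \<alpha> ({..m} - {i}) {..<m} \<and> (\<forall>(p, h)\<in>\<rho>. \<alpha> p = h)"

definition critical_assignment :: "nat \<Rightarrow> nat \<Rightarrow> (nat \<Rightarrow> nat) \<Rightarrow> assignment" where
  "critical_assignment m i \<alpha> v = (case prod_decode v of (p, h) \<Rightarrow> p \<le> m \<and> p \<noteq> i \<and> \<alpha> p = h)"

text \<open>The size of this set is the complexity measure of the lower bound. An assignment
  critical for \<open>i\<close> falsifies no pigeon axiom except that of \<open>i\<close>, so these
  are the pigeons whose axioms are needed to imply \<open>C\<close> on the critical assignments
  extending \<open>\<rho>\<close>.\<close>

definition missed :: "nat \<Rightarrow> (nat \<times> nat) set \<Rightarrow> clause \<Rightarrow> nat set" where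
  "missed m \<rho> C = {i. \<exists>\<alpha>. critical m \<rho> i \<alpha> \<and> falsifies (critical_assignment m i \<alpha>) C}"

text \<open>
  Under critical assignments every hole is occupied, so that a negative literal says that some other
  pigeon sits in the hole.
\<close>

definition positive_pairs :: "clause \<Rightarrow> (nat \<times> nat) set" where
  "positive_pairs C = {(i, h). Pos (pvar i h) \<in> C \<or> (\<exists>i'. i' \<noteq> i \<and> Neg (pvar i' h) \<in> C)}"

lemma critical_assignment_pvar [simp]:
  "critical_assignment m i \<alpha> (pvar p h) \<longleftrightarrow> p \<le> m \<and> p \<noteq> i \<and> \<alpha> p = h"
  by (simp add: critical_assignment_def)

lemma matching_finite: "matching m \<rho> \<Longrightarrow> finite \<rho>"
  unfolding matching_def by (rule finite_subset[of _ "{..m} \<times> {..<m}"]) auto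

lemma card_free:
  assumes "matching m \<rho>"
  shows "card (free_pigeons m \<rho>) = Suc m - card \<rho>" "card (free_holes m \<rho>) = m - card \<rho>"
proof -
  have fin: "finite \<rho>" by (rule matching_finite[OF assms])
  have f: "fst ` \<rho> \<subseteq> {..m}" "snd ` \<rho> \<subseteq> {..<m}" "card (fst ` \<rho>) = card \<rho>" "card (snd ` \<rho>) = card \<rho>"
    using assms by (auto simp: matching_def card_image)
  show "card (free_pigeons m \<rho>) = Suc m - card \<rho>"
    using f fin by (simp add: free_pigeons_def card_Diff_subset)
  show "card (free_holes m \<rho>) = m - card \<rho>"
    using f fin by (simp add: free_holes_def card_Diff_subset)
qed

lemma missed_subset: "missed m \<rho> C \<subseteq> free_pigeons m \<rho>"
  by (auto simp: missed_def critical_def)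

lemma finite_missed [simp]: "finite (missed m \<rho> C)"
  by (rule finite_subset[OF missed_subset]) (simp add: free_pigeons_def)

lemma missed_antimono: "C \<subseteq> D \<Longrightarrow> missed m \<rho> D \<subseteq> missed m \<rho> C"
  unfolding missed_def falsifies_def by blast

text \<open>An assignment falsifying the resolvent gives \<open>x\<close> some value and thereby
  falsifies one of the antecedents. Hence the measure is subadditive.\<close>

lemma missed_resolvent:
  "missed m \<rho> (A \<union> B) \<subseteq> missed m \<rho> (insert (Pos x) A) \<union> missed m \<rho> (insert (Neg x) B)"
proof
  fix i assume "i \<in> missed m \<rho> (A \<union> B)"
  then obtain \<alpha> where \<alpha>: "critical m \<rho> i \<alpha>" "falsifies (critical_assignment m i \<alpha>) (A \<union> B)"
    by (auto simp: missed_def)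
  show "i \<in> missed m \<rho> (insert (Pos x) A) \<union> missed m \<rho> (insert (Neg x) B)"
    using \<alpha> by (cases "critical_assignment m i \<alpha> x") (auto simp: missed_def falsifies_def)
qed

text \<open>Every assignment falsifies the empty clause, so it is enough to find a critical
  assignment for each free pigeon \<open>i\<close>. Once \<open>i\<close> is left out, there are as
  many free pigeons as free holes, and any bijection between them extends the matching.\<close>

lemma missed_empty:
  assumes "matching m \<rho>"
  shows "missed m \<rho> {} = free_pigeons m \<rho>"
proof (intro equalityI missed_subset subsetI)
  fix i assume i: "i \<in> free_pigeons m \<rho>"
  have fin: "finite \<rho>" by (rule matching_finite[OF assms])
  have inj: "inj_on fst \<rho>" "inj_on snd \<rho>" and sub: "\<rho> \<subseteq> {..m} \<times> {..<m}"
    using assms by (auto simp: matching_def)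
  have "card (free_pigeons m \<rho> - {i}) = card (free_holes m \<rho>)"
    using card_free[OF assms] i by (simp add: card_Diff_singleton)
  then obtain g where g: "bij_betw g (free_pigeons m \<rho> - {i}) (free_holes m \<rho>)"
    using finite_same_card_bij[of "free_pigeons m \<rho> - {i}" "free_holes m \<rho>"]
    by (auto simp: free_pigeons_def free_holes_def)
  \<comment> \<open>\<open>k\<close> reads the matching as a function on its pigeons;
    \<open>\<alpha>\<close> glues it to \<open>g\<close>.\<close>
  define k where "k = snd \<circ> inv_into \<rho> fst"
  have k: "k p = h" if "(p, h) \<in> \<rho>" for p h
    using inv_into_f_f[OF inj(1) that] by (simp add: k_def)
  have bk: "bij_betw k (fst ` \<rho>) (snd ` \<rho>)"
    unfolding k_def
    by (rule bij_betw_trans[of _ _ \<rho>])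
      (use inj in \<open>auto simp: bij_betw_def inj_on_inv_into inv_into_image_cancel
          intro: inv_into_into image_eqI\<close>)
  define \<alpha> where "\<alpha> p = (if p \<in> fst ` \<rho> then k p else g p)" for p
  have "bij_betw \<alpha> (fst ` \<rho> \<union> (free_pigeons m \<rho> - {i})) (snd ` \<rho> \<union> free_holes m \<rho>)"
  proof (rule bij_betw_combine)
    show "bij_betw \<alpha> (fst ` \<rho>) (snd ` \<rho>)"
      using bk by (rule bij_betw_cong[THEN iffD1, rotated]) (auto simp: \<alpha>_def)
    show "bij_betw \<alpha> (free_pigeons m \<rho> - {i}) (free_holes m \<rho>)"
      using g by (rule bij_betw_cong[THEN iffD1, rotated]) (auto simp: \<alpha>_def free_pigeons_def)
    show "snd ` \<rho> \<inter> free_holes m \<rho> = {}"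
      by (auto simp: free_holes_def)
  qed
  moreover have "fst ` \<rho> \<union> (free_pigeons m \<rho> - {i}) = {..m} - {i}"
    using sub i by (auto simp: free_pigeons_def)
  moreover have "snd ` \<rho> \<union> free_holes m \<rho> = {..<m}"
    using sub by (auto simp: free_holes_def)
  moreover have "\<forall>(p, h)\<in>\<rho>. \<alpha> p = h"
    using k by (force simp: \<alpha>_def)
  ultimately have "critical m \<rho> i \<alpha>"
    using i by (simp add: critical_def)
  then show "i \<in> missed m \<rho> {}"
    by (auto simp: missed_def falsifies_def)
qed

text \<open>
  If a clause misses \<open>i\<close> but not \<open>k\<close>, then moving pigeon \<open>i\<close> into the hole of pigeon \<open>k\<close> makes the
  clause true.
\<close>

lemma positive_pairs_row:
  assumes "matching m \<rho>" and i_missed: "i \<in> missed m \<rho> C"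
  shows "card (free_pigeons m \<rho> - missed m \<rho> C) \<le> card {h \<in> free_holes m \<rho>. (i, h) \<in> positive_pairs C}"
proof -
  obtain \<alpha> where \<alpha>: "critical m \<rho> i \<alpha>" and fals: "falsifies (critical_assignment m i \<alpha>) C"
    using i_missed by (auto simp: missed_def)
  have i: "i \<le> m" "i \<notin> fst ` \<rho>" and bij: "bij_betw \<alpha> ({..m} - {i}) {..<m}"
    and ext: "\<And>p h. (p, h) \<in> \<rho> \<Longrightarrow> \<alpha> p = h"
    using \<alpha> by (auto simp: critical_def free_pigeons_def)
  have inj: "inj_on \<alpha> ({..m} - {i})" using bij by (simp add: bij_betw_def)
  have "\<alpha> k \<in> free_holes m \<rho> \<and> (i, \<alpha> k) \<in> positive_pairs C"
    if k: "k \<in> free_pigeons m \<rho>" "k \<notin> missed m \<rho> C" for k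
  proof -
    have ki: "k \<noteq> i" using k i_missed by auto
    have km: "k \<le> m" "k \<notin> fst ` \<rho>" using k by (auto simp: free_pigeons_def)
    define \<beta> where "\<beta> = \<alpha>(i := \<alpha> k)"
    have "bij_betw \<beta> ({..m} - {k}) {..<m}"
    proof -
      have "bij_betw \<alpha> ({..m} - {i} - {k}) ({..<m} - {\<alpha> k})"
        using bij ki km by (intro bij_betw_DiffI) (auto simp: bij_betw_def)
      then have "bij_betw \<beta> ({..m} - {i} - {k}) ({..<m} - {\<alpha> k})"
        by (rule bij_betw_cong[THEN iffD1, rotated]) (auto simp: \<beta>_def)
      then have "bij_betw \<beta> (({..m} - {i} - {k}) \<union> {i}) (({..<m} - {\<alpha> k}) \<union> {\<alpha> k})"
        by (intro bij_betw_combine) (auto simp: \<beta>_def)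
      moreover have "({..m} - {i} - {k}) \<union> {i} = {..m} - {k}" using i ki by auto
      moreover have "({..<m} - {\<alpha> k}) \<union> {\<alpha> k} = {..<m}"
        using bij km ki by (auto simp: bij_betw_def)
      ultimately show ?thesis by simp
    qed
    moreover have "\<forall>(p, h)\<in>\<rho>. \<beta> p = h"
      using ext i(2) by (force simp: \<beta>_def)
    ultimately have "critical m \<rho> k \<beta>"
      using k by (simp add: critical_def)
    then have "\<not> falsifies (critical_assignment m k \<beta>) C"
      using k by (auto simp: missed_def)
    then obtain l where l: "l \<in> C" "lit_true (critical_assignment m k \<beta>) l"
      by (auto simp: falsifies_def)
    have nl: "\<not> lit_true (critical_assignment m i \<alpha>) l"
      using fals l by (auto simp: falsifies_def)
    \<comment> \<open>The two assignments differ in two variables only: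
      \<open>pvar i (\<alpha> k)\<close> becomes true and \<open>pvar k (\<alpha> k)\<close> becomes
      false. So \<open>l\<close> is the positive literal of the first or the negative literal of the
      second, and either one yields this pair.\<close>
    have "(i, \<alpha> k) \<in> positive_pairs C"
    proof (cases l)
      case (Pos v)
      obtain p h where v: "v = pvar p h" by (metis prod_decode_inverse surj_pair)
      have "p = i \<and> h = \<alpha> k"
        using l nl Pos v by (auto simp: \<beta>_def split: if_splits)
      then show ?thesis using l Pos v by (auto simp: positive_pairs_def)
    next
      case (Neg v)
      obtain p h where v: "v = pvar p h" by (metis prod_decode_inverse surj_pair)
      have "p = k \<and> h = \<alpha> k"
        using l nl Neg v by (auto simp: \<beta>_def split: if_splits)
      then show ?thesis using l Neg v ki by (auto simp: positive_pairs_def)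
    qed
    moreover have "\<alpha> k \<in> free_holes m \<rho>"
    proof -
      have "\<alpha> k \<in> {..<m}" using bij km ki by (auto simp: bij_betw_def)
      moreover have "\<alpha> k \<notin> snd ` \<rho>"
      proof
        assume "\<alpha> k \<in> snd ` \<rho>"
        then obtain p where p: "(p, \<alpha> k) \<in> \<rho>" by auto
        then have "\<alpha> p = \<alpha> k" "p \<noteq> i" "p \<noteq> k" using ext i(2) km(2) by force+
        moreover have "p \<le> m" using p \<open>matching m \<rho>\<close> by (auto simp: matching_def)
        ultimately show False using inj km ki by (auto simp: inj_on_def)
      qed
      ultimately show ?thesis by (simp add: free_holes_def)
    qed
    ultimately show ?thesis by blast
  qed
  then have "\<alpha> ` (free_pigeons m \<rho> - missed m \<rho> C) \<subseteq> {h \<in> free_holes m \<rho>. (i, h) \<in> positive_pairs C}"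
    by auto
  moreover have "inj_on \<alpha> (free_pigeons m \<rho> - missed m \<rho> C)"
    using inj i_missed by (auto intro: inj_on_subset simp: free_pigeons_def)
  ultimately show ?thesis
    by (intro card_inj_on_le) (auto simp: free_holes_def)
qed

text \<open>The row bounds are summed over the missed pigeons. A clause that misses many free
  pigeons, but also leaves many of them unmissed, thus has many positive pairs.\<close>

lemma card_positive_pairs:
  assumes "matching m \<rho>"
  shows "card (missed m \<rho> C) * card (free_pigeons m \<rho> - missed m \<rho> C)
         \<le> card (positive_pairs C \<inter> free_pigeons m \<rho> \<times> free_holes m \<rho>)"
proof -
  let ?S = "SIGMA i:missed m \<rho> C. {h \<in> free_holes m \<rho>. (i, h) \<in> positive_pairs C}"
  have "card (missed m \<rho> C) * card (free_pigeons m \<rho> - missed m \<rho> C)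
        \<le> (\<Sum>i\<in>missed m \<rho> C. card {h \<in> free_holes m \<rho>. (i, h) \<in> positive_pairs C})"
    using sum_bounded_below[of "missed m \<rho> C" "card (free_pigeons m \<rho> - missed m \<rho> C)"
        "\<lambda>i. card {h \<in> free_holes m \<rho>. (i, h) \<in> positive_pairs C}"]
      positive_pairs_row[OF assms] by simp
  also have "\<dots> = card ?S"
    by (rule card_SigmaI[symmetric]) (auto simp: free_holes_def)
  also have "\<dots> \<le> card (positive_pairs C \<inter> free_pigeons m \<rho> \<times> free_holes m \<rho>)"
    using missed_subset[of m \<rho> C]
    by (intro card_mono) (auto simp: free_pigeons_def free_holes_def)
  finally show ?thesis .
qed

text \<open>A positive pair inside the matching makes the clause true under all critical assignments
  extending the matching: pigeon \<open>p\<close> sits in hole \<open>h\<close>, and no other pigeon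
  does. This motivates the disjointness condition in \<open>wide\<close>.\<close>

lemma positive_pairs_disjoint:
  assumes "matching m \<rho>" "missed m \<rho> C \<noteq> {}"
  shows "positive_pairs C \<inter> \<rho> = {}"
proof (rule ccontr)
  assume "positive_pairs C \<inter> \<rho> \<noteq> {}"
  then obtain p h where ph: "(p, h) \<in> positive_pairs C" "(p, h) \<in> \<rho>" by auto
  obtain i \<alpha> where "critical m \<rho> i \<alpha>" and fals: "falsifies (critical_assignment m i \<alpha>) C"
    using assms(2) by (auto simp: missed_def)
  then have i: "i \<notin> fst ` \<rho>" and inj: "inj_on \<alpha> ({..m} - {i})" and "\<alpha> p = h"
    using ph(2) by (auto simp: critical_def free_pigeons_def bij_betw_def)
  moreover have "p \<le> m" "p \<noteq> i"
    using assms(1) ph(2) i by (force simp: matching_def)+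
  moreover have "Pos (pvar p h) \<in> C \<or> (\<exists>i'. i' \<noteq> p \<and> Neg (pvar i' h) \<in> C)"
    using ph(1) by (simp add: positive_pairs_def)
  ultimately show False
    using fals by (auto simp: falsifies_def inj_on_def)
qed

section \<open>Greedy removal of wide clauses\<close>

definition wide :: "nat \<Rightarrow> nat \<Rightarrow> (nat \<times> nat) set \<Rightarrow> clause \<Rightarrow> bool" where
  "wide m T \<rho> C \<longleftrightarrow> positive_pairs C \<inter> \<rho> = {} \<and>
     T \<le> card (positive_pairs C \<inter> free_pigeons m \<rho> \<times> free_holes m \<rho>)"

text \<open>Double counting: there are at least \<open>card L * T\<close> incidences between
  \<open>L\<close> and \<open>G\<close>, so the most frequent element of \<open>G\<close> lies in at
  least a fraction \<open>1 / q\<close> of the sets.\<close>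

lemma popular_element:
  assumes "finite G" "G \<noteq> {}" "finite L" "0 < T" "card G \<le> q * T"
    and "\<And>C. C \<in> L \<Longrightarrow> T \<le> card (S C \<inter> G)"
  obtains g where "g \<in> G" "card L \<le> q * card {C \<in> L. g \<in> S C}"
proof -
  define c where "c g = card {C \<in> L. g \<in> S C}" for g
  obtain g where g: "g \<in> G" "\<And>g'. g' \<in> G \<Longrightarrow> c g' \<le> c g"
    using assms(1,2) Max_in[of "c ` G"] Max_ge[of "c ` G"] by fastforce
  have "card L * T \<le> (\<Sum>C\<in>L. card (S C \<inter> G))"
    using sum_bounded_below[of L T "\<lambda>C. card (S C \<inter> G)"] assms(6) by simp
  also have "\<dots> = (\<Sum>C\<in>L. \<Sum>g\<in>G. if g \<in> S C then 1 else 0)"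
    using assms(1) by (intro sum.cong refl) (simp add: sum.If_cases Int_commute)
  also have "\<dots> = (\<Sum>g\<in>G. \<Sum>C\<in>L. if g \<in> S C then 1 else 0)"
    by (rule sum.swap)
  also have "\<dots> = (\<Sum>g\<in>G. c g)"
    using assms(3) by (intro sum.cong refl) (simp add: c_def sum.If_cases Int_def)
  also have "\<dots> \<le> card G * c g"
    using sum_bounded_above[of G c "c g"] g by simp
  also have "\<dots> \<le> q * T * c g"
    using assms(5) by (rule mult_le_mono1)
  finally have "card L * T \<le> (q * c g) * T"
    by (simp add: mult_ac)
  then have "card L \<le> q * c g"
    using assms(4) by simp
  then show ?thesis
    using that g(1) by (simp add: c_def)
qed

text \<open>The matching is extended by a most popular free pair. Every wide clause having it as a
  positive pair stops being wide, so each extension removes at least a fraction \<open>1 / q\<close>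
  of the wide clauses.\<close>

lemma matching_hitting_wide_clauses:
  fixes \<C> :: "clause set"
  assumes "finite \<C>" "0 < T" "0 < q" "Suc m * m \<le> q * T" "t \<le> m"
  shows "\<exists>\<rho>. matching m \<rho> \<and> card \<rho> = t \<and>
           real (card {C \<in> \<C>. wide m T \<rho> C}) \<le> (1 - 1 / real q) ^ t * real (card \<C>)"
  using assms(5)
proof (induction t)
  case 0
  have "card {C \<in> \<C>. wide m T {} C} \<le> card \<C>"
    using assms(1) by (intro card_mono) auto
  then show ?case
    by (intro exI[of _ "{}"]) (simp add: matching_def)
next
  case (Suc t)
  then obtain \<rho> where \<rho>: "matching m \<rho>" "card \<rho> = t"
    and le: "real (card {C \<in> \<C>. wide m T \<rho> C}) \<le> (1 - 1 / real q) ^ t * real (card \<C>)"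
    by auto
  define G where "G = free_pigeons m \<rho> \<times> free_holes m \<rho>"
  define L where "L = {C \<in> \<C>. wide m T \<rho> C}"
  have cG: "card G = (Suc m - t) * (m - t)"
    using card_free[OF \<rho>(1)] \<rho>(2) by (simp add: G_def card_cartesian_product)
  also have "\<dots> \<le> Suc m * m"
    by (intro mult_le_mono) auto
  finally have "card G \<le> q * T"
    using assms(4) by linarith
  moreover have "G \<noteq> {}"
  proof
    assume "G = {}"
    then show False using cG Suc.prems by simp
  qed
  moreover have "finite G" "finite L"
    using assms(1) by (auto simp: G_def L_def free_pigeons_def free_holes_def)
  moreover have "T \<le> card (positive_pairs C \<inter> G)" if "C \<in> L" for C
    using that by (auto simp: L_def G_def wide_def)
  ultimately obtain g where g: "g \<in> G" "card L \<le> q * card {C \<in> L. g \<in> positive_pairs C}"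
    using popular_element[of G L T q positive_pairs] assms(2) by blast
  obtain p h where ph: "g = (p, h)" by force
  have new: "p \<notin> fst ` \<rho>" "h \<notin> snd ` \<rho>" "p \<le> m" "h < m"
    using g(1) by (auto simp: G_def ph free_pigeons_def free_holes_def)
  let ?\<rho> = "insert g \<rho>"
  have m: "matching m ?\<rho>"
    using \<rho>(1) new by (auto simp: matching_def ph)
  have c: "card ?\<rho> = Suc t"
  proof -
    have "g \<notin> \<rho>" using new(1) by (auto simp: ph image_iff)
    then show ?thesis using matching_finite[OF \<rho>(1)] \<rho>(2) by simp
  qed
  \<comment> \<open>A larger matching leaves a smaller free grid, so no clause becomes wide
    anew.\<close>
  have "wide m T \<rho> C" if "wide m T ?\<rho> C" for C
  proof -
    have "positive_pairs C \<inter> free_pigeons m ?\<rho> \<times> free_holes m ?\<rho> \<subseteq> positive_pairs C \<inter> G"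
      by (auto simp: G_def free_pigeons_def free_holes_def)
    then have "card (positive_pairs C \<inter> free_pigeons m ?\<rho> \<times> free_holes m ?\<rho>) \<le> card (positive_pairs C \<inter> G)"
      using \<open>finite G\<close> by (intro card_mono) auto
    then show ?thesis
      using that by (auto simp: wide_def G_def)
  qed
  then have sub: "{C \<in> \<C>. wide m T ?\<rho> C} \<subseteq> L - {C \<in> L. g \<in> positive_pairs C}"
    by (auto simp: L_def wide_def)
  have "card {C \<in> \<C>. wide m T ?\<rho> C} \<le> card (L - {C \<in> L. g \<in> positive_pairs C})"
    using \<open>finite L\<close> by (intro card_mono sub) auto
  also have "\<dots> = card L - card {C \<in> L. g \<in> positive_pairs C}"
    using \<open>finite L\<close> by (intro card_Diff_subset) auto
  finally have "real (card {C \<in> \<C>. wide m T ?\<rho> C})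
      \<le> real (card L) - real (card {C \<in> L. g \<in> positive_pairs C})"
    using card_mono[of L "{C \<in> L. g \<in> positive_pairs C}"] \<open>finite L\<close> by auto
  also have "\<dots> \<le> real (card L) - real (card L) / real q"
  proof -
    have "real (card L) \<le> real q * real (card {C \<in> L. g \<in> positive_pairs C})"
      using g(2) by (simp flip: of_nat_mult)
    then show ?thesis
      using assms(3) by (simp add: field_simps)
  qed
  also have "\<dots> = (1 - 1 / real q) * real (card L)"
    by (simp add: algebra_simps)
  also have "\<dots> \<le> (1 - 1 / real q) * ((1 - 1 / real q) ^ t * real (card \<C>))"
    using le assms(3) by (intro mult_left_mono) (auto simp: L_def field_simps)
  finally show ?case
    using m c by (intro exI[of _ ?\<rho>]) (simp add: mult_ac)
qed

section \<open>Resolution steps under a partial matching\<close>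

lemma formula_of_Nil [simp]: "formula_of [] C = 0"
  by (simp add: formula_of_def)

lemma formula_of_Cons [simp]:
  "formula_of ((D, w) # ws) C = (if D = C then w else 0) + formula_of ws C"
  by (simp add: formula_of_def)

lemma formula_of_nonzero: "formula_of ws C \<noteq> 0 \<Longrightarrow> C \<in> fst ` set ws"
proof (induction ws)
  case (Cons a ws)
  obtain D w where a: "a = (D, w)" by (cases a) 
  show ?case 
  proof (cases "D = C")
   case False
   then have "formula_of ws C \<noteq> 0" using Cons.prems unfolding a by simp
   then show ?thesis using Cons.IH by simp
   qed (simp add: a)
qed simp

lemma or_not_superset: "D \<in> set (or_not E ls) \<Longrightarrow> E \<subseteq> D"
proof (induction ls arbitrary: E)
  case (Cons l ls)
  then have "D = insert (compl l) E \<or> insert l E \<subseteq> D" by auto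
  then show ?case by blast
qed simp

text \<open>By subadditivity the resolvent misses fewer than \<open>2 * u\<close> pigeons. It is
  therefore not empty, since the empty clause misses all free pigeons, and by \<open>gap\<close> it
  even misses fewer than \<open>u\<close>. The other consequents contain an antecedent and so miss
  no more than it does. Boxes are neither used nor produced.\<close>

lemma resolution_step_missed:
  assumes "matching m \<rho>" "2 * u \<le> card (free_pigeons m \<rho>)" "step Res F F'"
    and small: "\<And>C. C \<noteq> {} \<Longrightarrow> F C \<noteq> 0 \<Longrightarrow> card (missed m \<rho> C) < u"
    and gap: "\<And>C. F' C \<noteq> 0 \<Longrightarrow> card (missed m \<rho> C) < u \<or> 2 * u \<le> card (missed m \<rho> C)"
  shows "F' {} = F {} \<and> (\<forall>C. C \<noteq> {} \<longrightarrow> F' C \<noteq> 0 \<longrightarrow> card (missed m \<rho> C) < u)"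
proof -
  obtain P Q R where "resolution P Q" and F: "F = (\<lambda>C. R C + P C)" and F': "F' = (\<lambda>C. R C + Q C)"
    using assms(3) by (auto simp: step_def Res_def)
  then obtain A B x v w k xA xB where
    vw: "0 < v" "0 < w" "k = min v w" and
    xAB: "xA = insert (Pos x) (set A)" "xB = insert (Neg x) (set B)" and
    P: "P = formula_of [(xA, v), (xB, w)]" and
    Q: "Q = formula_of (discard_tautologies
       ([(set A \<union> set B, k), (xA, v - k), (xB, w - k)]
        @ map (\<lambda>C. (C, k)) (or_not xA B)
        @ map (\<lambda>C. (C, k)) (or_not xB A)))"
    by (auto elim: resolution.cases)
  have sA: "card (missed m \<rho> xA) < u" and sB: "card (missed m \<rho> xB) < u"
    using vw by (auto intro!: small simp: F P xAB)
  have "card (missed m \<rho> (set A \<union> set B)) \<le> card (missed m \<rho> xA \<union> missed m \<rho> xB)"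
    unfolding xAB by (intro card_mono missed_resolvent) simp
  also have "\<dots> \<le> card (missed m \<rho> xA) + card (missed m \<rho> xB)"
    by (rule card_Un_le)
  finally have r: "card (missed m \<rho> (set A \<union> set B)) < 2 * u"
    using sA sB by linarith
  then have ne: "set A \<union> set B \<noteq> {}"
    using missed_empty[OF assms(1)] assms(2) by (metis leD)
  have weak: "card (missed m \<rho> D) < u" if "E \<subseteq> D" "card (missed m \<rho> E) < u" for D E
    using that card_mono[OF _ missed_antimono[of E D m \<rho>]] by (meson finite_missed le_less_trans)
  have Qsmall: "C \<noteq> {} \<and> card (missed m \<rho> C) < u" if C: "Q C \<noteq> 0" for C
  proof -
    have "C = set A \<union> set B \<or> xA \<subseteq> C \<or> xB \<subseteq> C"
      using formula_of_nonzero[OF C[unfolded Q]] or_not_superset[of C xA B] or_not_superset[of C xB A]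
      by (auto simp: discard_tautologies_def split: if_splits)
    then consider "C = set A \<union> set B" | "xA \<subseteq> C" | "xB \<subseteq> C"
      by blast
    then show ?thesis
    proof cases
      case 1
      then have "F' C \<noteq> 0" using C by (simp add: F')
      then show ?thesis using gap 1 ne r by force
    qed (use weak[OF _ sA] weak[OF _ sB] xAB in auto)
  qed
  have "P {} = 0" "Q {} = 0"
    using Qsmall by (auto simp: P xAB formula_of_def)
  moreover have "card (missed m \<rho> C) < u" if "C \<noteq> {}" "F' C \<noteq> 0" for C
  proof (cases "R C = 0")
    case True
    then show ?thesis using Qsmall that by (simp add: F')
  next
    case False
    then show ?thesis using small that by (simp add: F)
  qed
  ultimately show ?thesis
    by (simp add: F F')
qed

text \<open>If there are few clauses, some matching of size \<open>3 * u\<close> leaves none of them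
  wide. Then no clause misses between \<open>u\<close> and \<open>2 * u\<close> of the remaining
  pigeons, and by \<open>resolution_step_missed\<close> the weight of the box stays constant along
  the proof.\<close>

lemma resolution_size_lower_bound:
  assumes "is_proof Res \<pi>" "Suc m = 6 * u" "finite \<C>"
    and \<C>: "\<And>G C. G \<in> set \<pi> \<Longrightarrow> G C \<noteq> 0 \<Longrightarrow> C \<in> \<C>"
    and init: "\<And>\<rho> C. C \<noteq> {} \<Longrightarrow> hd \<pi> C \<noteq> 0 \<Longrightarrow> card (missed m \<rho> C) < u"
    and box: "last \<pi> {} \<noteq> hd \<pi> {}"
  shows "(36 / 35) ^ (3 * u) \<le> real (card \<C>)"
proof (rule ccontr)
  assume *: "\<not> ?thesis"
  have u: "0 < u" using assms(2) by (cases u) auto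
  \<comment> \<open>The width threshold is \<open>u * u\<close>. The grid has at most 36 times as
    many cells, which gives \<open>q = 36\<close> and the decay factor 35/36.\<close>
  have "Suc m * m \<le> 36 * (u * u)"
    using assms(2) mult_le_mono[of "Suc m" "6 * u" m "6 * u"] by simp
  moreover have "3 * u \<le> m"
    using assms(2) u by linarith
  ultimately obtain \<rho> where \<rho>: "matching m \<rho>" "card \<rho> = 3 * u"
    and le: "real (card {C \<in> \<C>. wide m (u * u) \<rho> C}) \<le> (1 - 1 / real 36) ^ (3 * u) * real (card \<C>)"
    using matching_hitting_wide_clauses[of \<C> "u * u" 36 m "3 * u"] assms(3) u by auto
  note le
  also have "(1 - 1 / real 36) ^ (3 * u) * real (card \<C>) < (35 / 36) ^ (3 * u) * (36 / 35) ^ (3 * u)"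
    using * by simp
  also have "\<dots> = 1"
    by (simp flip: power_mult_distrib)
  \<comment> \<open>The number of wide clauses is a natural number below 1.\<close>
  finally have nowide: "\<not> wide m (u * u) \<rho> C" if "C \<in> \<C>" for C
    using that assms(3) by simp
  have free: "card (free_pigeons m \<rho>) = 3 * u"
    using card_free[OF \<rho>(1)] \<rho>(2) assms(2) by simp
  have gap: "card (missed m \<rho> C) < u \<or> 2 * u \<le> card (missed m \<rho> C)" if "C \<in> \<C>" for C
  proof (rule ccontr)
    assume c: "\<not> ?thesis"
    have "card (free_pigeons m \<rho> - missed m \<rho> C) = 3 * u - card (missed m \<rho> C)"
      using free missed_subset[of m \<rho> C] by (simp add: card_Diff_subset)
    \<comment> \<open>At least \<open>u\<close> pigeons are missed, and of the \<open>3 * u\<close>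
      free ones more than \<open>u\<close> are not.\<close>
    then have "u * u \<le> card (missed m \<rho> C) * card (free_pigeons m \<rho> - missed m \<rho> C)"
      using c by (intro mult_le_mono) auto
    also note card_positive_pairs[OF \<rho>(1)]
    finally have "u * u \<le> card (positive_pairs C \<inter> free_pigeons m \<rho> \<times> free_holes m \<rho>)" .
    moreover have "missed m \<rho> C \<noteq> {}"
      using c u by auto
    ultimately have "wide m (u * u) \<rho> C"
      using positive_pairs_disjoint[OF \<rho>(1)] by (auto simp: wide_def)
    then show False using nowide that by blast
  qed
  have ne: "\<pi> \<noteq> []" and steps: "\<And>i. Suc i < length \<pi> \<Longrightarrow> step Res (\<pi> ! i) (\<pi> ! Suc i)"
    using assms(1) by (auto simp: is_proof_def)
  have "(\<pi> ! i) {} = hd \<pi> {} \<and> (\<forall>C. C \<noteq> {} \<longrightarrow> (\<pi> ! i) C \<noteq> 0 \<longrightarrow> card (missed m \<rho> C) < u)"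
    if "i < length \<pi>" for i
    using that
  proof (induction i)
    case 0
    then show ?case using init ne by (simp add: hd_conv_nth)
  next
    case (Suc i)
    then have IH: "(\<pi> ! i) {} = hd \<pi> {}"
      "\<And>C. C \<noteq> {} \<Longrightarrow> (\<pi> ! i) C \<noteq> 0 \<Longrightarrow> card (missed m \<rho> C) < u"
      by auto
    have "\<And>C. (\<pi> ! Suc i) C \<noteq> 0 \<Longrightarrow> card (missed m \<rho> C) < u \<or> 2 * u \<le> card (missed m \<rho> C)"
      using gap \<C> Suc.prems nth_mem by blast
    then show ?case
      using resolution_step_missed[OF \<rho>(1) _ steps[OF Suc.prems] IH(2)] free IH(1) by simp
  qed
  then show False
    using box ne by (simp add: last_conv_nth)
qed


section \<open>Splitting and merging\<close>

definition literals_below :: "nat \<Rightarrow> clause" where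
  "literals_below V = Pos ` {..<V} \<union> Neg ` {..<V}"

definition unit_formula :: "clause multiset \<Rightarrow> wformula" where
  "unit_formula M = (\<lambda>C. of_nat (count M C))"

text \<open>The bound \<open>V\<close> on the variables controls the length of words. The conditions
  on \<open>A\<close> and \<open>x\<close> keep both halves free of tautologies and make a single
  resolution step undo the split.\<close>

definition split_rel :: "nat \<Rightarrow> (clause multiset \<times> clause multiset) set" where
  "split_rel V = {(R + {#A#}, R + {#insert (Pos x) A, insert (Neg x) A#}) | R A x.
     x < V \<and> A \<subseteq> literals_below V \<and> \<not> tautology A \<and> Pos x \<notin> A \<and> Neg x \<notin> A}"

definition split_equiv :: "nat \<Rightarrow> nat \<Rightarrow> clause multiset \<Rightarrow> clause multiset \<Rightarrow> bool" where
  "split_equiv V t M N \<longleftrightarrow> (M, N) \<in> (split_rel V \<union> (split_rel V)\<inverse>) ^^ t"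

lemma finite_literals_below [simp]: "finite (literals_below V)"
  by (simp add: literals_below_def)

lemma card_literals_below: "card (literals_below V) \<le> 2 * V"
  unfolding literals_below_def
  by (rule order_trans[OF card_Un_le]) (simp add: card_image inj_on_def)

lemma formula_of_unit: "formula_of (map (\<lambda>C. (C, 1)) Cs) = unit_formula (mset Cs)"
proof
  fix C
  show "formula_of (map (\<lambda>C. (C, 1)) Cs) C = unit_formula (mset Cs) C"
    by (induction Cs) (auto simp: unit_formula_def)
qed

text \<open>Each listed clause contains the complement of a literal that is already in
  \<open>E\<close>. For antecedents with the same side clause, this removes all compensating
  clauses.\<close>

lemma or_not_tautology: "set ls \<subseteq> E \<Longrightarrow> D \<in> set (or_not E ls) \<Longrightarrow> tautology D"
proof (induction ls arbitrary: E)
  case (Cons l ls)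
  have "tautology (insert (compl l) E)"
    using Cons.prems(1) by (cases l) (auto simp: tautology_def)
  then show ?case using Cons by (auto simp: insert_absorb)
qed simp

text \<open>The converse step resolves the two halves on \<open>x\<close>. The resolvent is
  \<open>A\<close>, the halves keep weight \<open>1 - 1 = 0\<close>, and the compensating clauses
  are tautologies, so nothing but \<open>A\<close> remains.\<close>

lemma split_step:
  assumes "(M, N) \<in> split_rel V"
  shows "step ResS (unit_formula M) (unit_formula N)" "step ResS (unit_formula N) (unit_formula M)"
proof -
  obtain R A x where M: "M = R + {#A#}" and N: "N = R + {#insert (Pos x) A, insert (Neg x) A#}"
    and A: "A \<subseteq> literals_below V" "\<not> tautology A" "Pos x \<notin> A" "Neg x \<notin> A"
    using assms by (auto simp: split_rel_def)
  have fin: "finite A"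
    using A(1) finite_literals_below finite_subset by blast
  have nt: "\<not> tautology (insert (Pos x) A)" "\<not> tautology (insert (Neg x) A)"
    using A by (auto simp: tautology_def)
  let ?P = "formula_of [(A, 1)]" and ?Q = "formula_of [(insert (Pos x) A, 1), (insert (Neg x) A, 1)]"
  have uM: "unit_formula M = (\<lambda>C. unit_formula R C + ?P C)"
    using formula_of_unit[of "[A]"] by (auto simp: M unit_formula_def fun_eq_iff)
  have uN: "unit_formula N = (\<lambda>C. unit_formula R C + ?Q C)"
    using formula_of_unit[of "[insert (Pos x) A, insert (Neg x) A]"]
    by (auto simp: N unit_formula_def fun_eq_iff)
  have "split ?P (formula_of (discard_tautologies [(insert (Pos x) A, 1), (insert (Neg x) A, 1)]))"
    using fin by (intro split.intros) auto
  then have "split ?P ?Q"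
    using nt by (simp add: discard_tautologies_def)
  then show "step ResS (unit_formula M) (unit_formula N)"
    unfolding step_def ResS_def using uM uN by blast
  obtain As where As: "set As = A" "distinct As"
    using fin finite_distinct_list by blast
  have empty: "filter (\<lambda>(C, w). \<not> tautology C)
      (map (\<lambda>C. (C, 1::ennreal)) (or_not (insert l A) As)) = []" for l
    using or_not_tautology[of As "insert l A"] As by (auto simp: filter_empty_conv)
  have "resolution ?Q (formula_of (discard_tautologies
       ([(set As \<union> set As, 1), (insert (Pos x) A, 1 - 1), (insert (Neg x) A, 1 - 1)]
        @ map (\<lambda>C. (C, 1)) (or_not (insert (Pos x) A) As)
        @ map (\<lambda>C. (C, 1)) (or_not (insert (Neg x) A) As))))"
    using As A by (intro resolution.intros) auto
  moreover have "formula_of (discard_tautologies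
       ([(set As \<union> set As, 1), (insert (Pos x) A, 1 - 1), (insert (Neg x) A, 1 - 1)]
        @ map (\<lambda>C. (C, 1)) (or_not (insert (Pos x) A) As)
        @ map (\<lambda>C. (C, 1)) (or_not (insert (Neg x) A) As))) = ?P"
    using nt A As empty by (auto simp: discard_tautologies_def fun_eq_iff)
  ultimately have "resolution ?Q ?P" by simp
  then show "step ResS (unit_formula N) (unit_formula M)"
    unfolding step_def ResS_def using uM uN by blast
qed

lemma split_equiv_refl: "split_equiv V 0 M M"
  by (simp add: split_equiv_def)

lemma split_equiv_trans:
  "split_equiv V s L M \<Longrightarrow> split_equiv V t M N \<Longrightarrow> split_equiv V (s + t) L N"
  unfolding split_equiv_def relpow_add by blast

lemma split_equiv_sym:
  assumes "split_equiv V t M N"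
  shows "split_equiv V t N M"
  using assms
proof (induction t arbitrary: N)
  case (Suc t)
  then obtain L where "split_equiv V t L M" "(N, L) \<in> split_rel V \<union> (split_rel V)\<inverse>"
    by (auto simp: split_equiv_def)
  then show ?case
    unfolding split_equiv_def by (intro relpow_Suc_I2)
qed (simp add: split_equiv_def)

lemma split_rel_add: "(M, N) \<in> split_rel V \<Longrightarrow> (M + K, N + K) \<in> split_rel V"
  unfolding split_rel_def by (force simp: ac_simps)

lemma split_equiv_add_right:
  assumes "split_equiv V t M N"
  shows "split_equiv V t (M + K) (N + K)"
  using assms
proof (induction t arbitrary: N)
  case (Suc t)
  then obtain L where "split_equiv V t M L" "(L, N) \<in> split_rel V \<union> (split_rel V)\<inverse>"
    by (auto simp: split_equiv_def)
  then have "split_equiv V t (M + K) (L + K)" "(L + K, N + K) \<in> split_rel V \<union> (split_rel V)\<inverse>"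
    using Suc.IH split_rel_add by auto
  then show ?case
    by (auto simp: split_equiv_def)
qed (simp add: split_equiv_def)

lemma split_equiv_add:
  assumes "split_equiv V s M N" "split_equiv V t K L"
  shows "split_equiv V (s + t) (M + K) (N + L)"
proof -
  have "split_equiv V t (N + K) (N + L)"
    using split_equiv_add_right[OF assms(2), of N] by (simp add: add.commute)
  then show ?thesis
    using split_equiv_trans split_equiv_add_right[OF assms(1)] by blast
qed

lemma split_equiv_sum:
  assumes "finite I" "\<And>i. i \<in> I \<Longrightarrow> split_equiv V (t i) (M i) (N i)"
  shows "split_equiv V (\<Sum>i\<in>I. t i) (\<Sum>i\<in>I. M i) (\<Sum>i\<in>I. N i)"
  using assms by (induction I rule: finite_induct) (auto intro: split_equiv_refl split_equiv_add)

text \<open>\<open>A\<close> is split on \<open>f 0\<close>, the positive half on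
  \<open>f 1\<close>, and so on; the negative halves stay behind as the summands.\<close>

lemma split_equiv_chain:
  assumes "A \<subseteq> literals_below V" "\<not> tautology A" "inj_on f {..<k}" "\<And>j. j < k \<Longrightarrow> f j < V"
    and "\<And>j. j < k \<Longrightarrow> Pos (f j) \<notin> A \<and> Neg (f j) \<notin> A"
  shows "split_equiv V k {#A#}
    ({#A \<union> Pos ` f ` {..<k}#} + (\<Sum>j<k. {#insert (Neg (f j)) (A \<union> Pos ` f ` {..<j})#}))"
  using assms(3-5)
proof (induction k)
  case 0
  then show ?case by (simp add: split_equiv_refl)
next
  case (Suc k)
  let ?A = "A \<union> Pos ` f ` {..<k}" and ?S = "\<Sum>j<k. {#insert (Neg (f j)) (A \<union> Pos ` f ` {..<j})#}"
  have "split_equiv V k {#A#} ({#?A#} + ?S)"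
    using Suc by (intro Suc.IH) (auto simp: lessThan_Suc)
  moreover have "(?S + {#?A#}, ?S + {#insert (Pos (f k)) ?A, insert (Neg (f k)) ?A#}) \<in> split_rel V"
  proof -
    have "f k < V" "Pos (f k) \<notin> A" "Neg (f k) \<notin> A" using Suc.prems by auto
    moreover have "f k \<notin> f ` {..<k}" using Suc.prems(1) by (fastforce dest: inj_onD)
    moreover have "?A \<subseteq> literals_below V"
      using assms(1) Suc.prems(2) by (force simp: literals_below_def)
    moreover have "\<not> tautology ?A"
      using assms(2) Suc.prems(3) by (auto simp: tautology_def)
    ultimately show ?thesis
      unfolding split_rel_def by blast
  qed
  moreover have "?A \<union> {Pos (f k)} = A \<union> Pos ` f ` {..<Suc k}"
    by (auto simp: lessThan_Suc)
  ultimately show ?case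
    by (auto simp: split_equiv_def ac_simps lessThan_Suc add_mset_commute)
qed

section \<open>Decomposition by the first true variable\<close>

definition all_pos :: "(nat \<Rightarrow> nat) \<Rightarrow> nat \<Rightarrow> clause" where
  "all_pos f k = Pos ` f ` {..<k}"

text \<open>Falsified exactly by the assignments for which \<open>f j\<close> is the first true
  variable of the sequence \<open>f\<close>.\<close>

definition first_at :: "(nat \<Rightarrow> nat) \<Rightarrow> nat \<Rightarrow> clause" where
  "first_at f j = insert (Neg (f j)) (Pos ` f ` {..<j})"

text \<open>
  The clauses of \<open>not_first_at f j\<close> are falsified by disjoint sets of assignments; together these are
  the assignments making \<open>f j\<close> and some earlier variable true.
\<close>

definition not_first_at :: "(nat \<Rightarrow> nat) \<Rightarrow> nat \<Rightarrow> clause multiset" where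
  "not_first_at f j = (\<Sum>k<j. {#insert (Neg (f k)) (insert (Neg (f j)) (Pos ` f ` {..<k}))#})"

lemma split_equiv_box:
  assumes "inj f" "\<And>j. j < k \<Longrightarrow> f j < V"
  shows "split_equiv V k {#{}#} ({#all_pos f k#} + (\<Sum>j<k. {#first_at f j#}))"
  using split_equiv_chain[of "{}" V f k] assms
  by (simp add: tautology_def all_pos_def first_at_def inj_on_def)

text \<open>The unit clause is split over the earlier variables: the leaf with all of them positive
  is \<open>first_at f j\<close>, and the other leaves are \<open>not_first_at f j\<close>.\<close>

lemma split_equiv_unit:
  assumes "inj f" "\<And>k. k \<le> j \<Longrightarrow> f k < V"
  shows "split_equiv V j {#{Neg (f j)}#} ({#first_at f j#} + not_first_at f j)"
proof -
  have "f k \<noteq> f j" if "k < j" for k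
    using that assms(1) by (auto dest: injD)
  then show ?thesis
    using split_equiv_chain[of "{Neg (f j)}" V f j] assms
    by (simp add: tautology_def first_at_def not_first_at_def inj_on_def literals_below_def)
qed


section \<open>The pigeonhole formula\<close>

text \<open>
  The boxes are the reserve that \<open>ResS\<close> can split. The hole axioms come with additional literals, so
  that the total weight falsified in an occupied hole is one less than the number of its pigeons.
\<close>

definition php :: "nat \<Rightarrow> clause multiset" where
  "php m = replicate_mset m {} + (\<Sum>i\<le>m. {#all_pos (pvar i) m#})
     + (\<Sum>i\<le>m. \<Sum>j<m. not_first_at (\<lambda>i. pvar i j) i)"

text \<open>The counterpart of \<open>php\<close> with pigeons and holes exchanged: every hole is
  used, no pigeon sits in two holes. It has one more box.\<close>

definition php_refuted :: "nat \<Rightarrow> clause multiset" where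
  "php_refuted m = replicate_mset (Suc m) {} + (\<Sum>j<m. {#all_pos (\<lambda>i. pvar i j) (Suc m)#})
     + (\<Sum>i\<le>m. \<Sum>j<m. not_first_at (pvar i) j)"

lemma pvar_bound:
  assumes "i \<le> m" "j \<le> m"
  shows "pvar i j < 4 * Suc m * Suc m"
proof -
  have "(i + j) * Suc (i + j) div 2 \<le> (i + j) * Suc (i + j)"
    by (rule div_le_dividend)
  also have "\<dots> \<le> (2 * m) * Suc (2 * m)"
    using assms by (intro mult_le_mono) auto
  finally show ?thesis
    using assms by (simp add: prod_encode_def triangle_def algebra_simps)
qed

lemma inj_pvar [simp]: "inj (pvar i)" "inj (\<lambda>i. pvar i j)"
  by (auto simp: inj_on_def)

lemma replicate_mset_eq_sum: "replicate_mset m x = (\<Sum>i<m. {#x#})"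
  by (induction m) auto

lemma php_split_equiv:
  "\<exists>t \<le> 4 * Suc m ^ 3. split_equiv (4 * Suc m * Suc m) t (php m) (php_refuted m)"
proof -
  let ?V = "4 * Suc m * Suc m"
  define P where "P = (\<Sum>i\<le>m. {#all_pos (pvar i) m#})"
  define E where "E = (\<Sum>j<m. {#all_pos (\<lambda>i. pvar i j) (Suc m)#})"
  define H where "H = (\<Sum>i\<le>m. \<Sum>j<m. {#first_at (\<lambda>i. pvar i j) i#})"
  define G where "G = (\<Sum>i\<le>m. \<Sum>j<m. not_first_at (\<lambda>i. pvar i j) i)"
  define U where "U = (\<Sum>i\<le>m. \<Sum>j<m. {#{Neg (pvar i j)}#})"
  define Q where "Q = (\<Sum>i\<le>m. \<Sum>j<m. {#first_at (pvar i) j#})"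
  define D where "D = (\<Sum>i\<le>m. \<Sum>j<m. not_first_at (pvar i) j)"
  have H_swap: "H = (\<Sum>j<m. \<Sum>i<Suc m. {#first_at (\<lambda>i. pvar i j) i#})"
    unfolding H_def lessThan_Suc_atMost by (rule sum.swap)
  have box: "replicate_mset k {} = (\<Sum>j<k. {#{}#})" for k :: nat
    by (rule replicate_mset_eq_sum)
  \<comment> \<open>One box per hole, distributed over the first pigeon in that hole.\<close>
  have "split_equiv ?V (\<Sum>j<m. Suc m) (\<Sum>j<m. {#{}#})
      (\<Sum>j<m. {#all_pos (\<lambda>i. pvar i j) (Suc m)#} + (\<Sum>i<Suc m. {#first_at (\<lambda>i. pvar i j) i#}))"
    by (intro split_equiv_sum split_equiv_box pvar_bound inj_pvar) auto
  then have 1: "split_equiv ?V (m * Suc m) (replicate_mset m {}) (E + H)"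
    by (simp only: box E_def H_swap sum.distrib sum_constant card_lessThan of_nat_id)
  \<comment> \<open>The unit clauses are decomposed in two ways: here by the earlier pigeons of the
    same hole, in \<open>3\<close> by the earlier holes of the same pigeon.\<close>
  have 2: "split_equiv ?V (\<Sum>i\<le>m. \<Sum>j<m. i) U (H + G)"
    unfolding U_def H_def G_def sum.distrib[symmetric]
    by (intro split_equiv_sum split_equiv_unit[of "\<lambda>i. pvar i _"] pvar_bound inj_pvar) auto
  have 3: "split_equiv ?V (\<Sum>i\<le>m. \<Sum>j<m. j) U (Q + D)"
    unfolding U_def Q_def D_def sum.distrib[symmetric]
    by (intro split_equiv_sum split_equiv_unit[of "pvar _"] pvar_bound inj_pvar) auto
  \<comment> \<open>One box per pigeon, distributed over its first hole; read backwards, this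
    creates the \<open>m + 1\<close> boxes.\<close>
  have "split_equiv ?V (\<Sum>i\<le>m. m) (\<Sum>i\<le>m. {#{}#})
      (\<Sum>i\<le>m. {#all_pos (pvar i) m#} + (\<Sum>j<m. {#first_at (pvar i) j#}))"
    by (intro split_equiv_sum split_equiv_box pvar_bound inj_pvar) auto
  then have 4: "split_equiv ?V (Suc m * m) (replicate_mset (Suc m) {}) (P + Q)"
    by (simp only: box P_def Q_def sum.distrib lessThan_Suc_atMost sum_constant card_atMost of_nat_id)
  \<comment> \<open>The refutation splits boxes by \<open>1\<close>, merges to unit clauses by
    \<open>2\<close>, splits these by \<open>3\<close>, and merges with the pigeon axioms
    \<open>P\<close> to boxes by \<open>4\<close>.\<close>
  have "split_equiv ?V (m * Suc m) (replicate_mset m {} + P + G) (E + P + (H + G))"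
    using split_equiv_add_right[OF 1, of "P + G"] by (simp add: ac_simps)
  moreover have "split_equiv ?V (\<Sum>i\<le>m. \<Sum>j<m. i) (E + P + (H + G)) (E + P + U)"
    using split_equiv_add_right[OF split_equiv_sym[OF 2], of "E + P"] by (simp add: ac_simps)
  moreover have "split_equiv ?V (\<Sum>i\<le>m. \<Sum>j<m. j) (E + P + U) (P + Q + (E + D))"
    using split_equiv_add_right[OF 3, of "E + P"] by (simp add: ac_simps)
  moreover have "split_equiv ?V (Suc m * m) (P + Q + (E + D)) (replicate_mset (Suc m) {} + E + D)"
    using split_equiv_add_right[OF split_equiv_sym[OF 4], of "E + D"] by (simp add: ac_simps)
  ultimately have "split_equiv ?V (m * Suc m + (\<Sum>i\<le>m. \<Sum>j<m. i) + (\<Sum>i\<le>m. \<Sum>j<m. j) + Suc m * m)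
      (php m) (php_refuted m)"
    unfolding php_def php_refuted_def P_def[symmetric] E_def[symmetric] G_def[symmetric] D_def[symmetric]
    by (intro split_equiv_trans)
  moreover have "m * Suc m + (\<Sum>i\<le>m. \<Sum>j<m. i) + (\<Sum>i\<le>m. \<Sum>j<m. j) + Suc m * m \<le> 4 * Suc m ^ 3"
  proof -
    have "(\<Sum>i\<le>m. \<Sum>j<m. i) \<le> (\<Sum>i\<le>m. \<Sum>j<m. Suc m)" "(\<Sum>i\<le>m. \<Sum>j<m. j) \<le> (\<Sum>i\<le>m. \<Sum>j<m. Suc m)"
      by (intro sum_mono; simp)+
    moreover have "(\<Sum>i\<le>m. \<Sum>j<m. Suc m) = Suc m * (m * Suc m)"
      by simp
    moreover have "Suc m * (m * Suc m) \<le> Suc m ^ 3" "m * Suc m \<le> Suc m ^ 3"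
      by (simp_all add: power3_eq_cube algebra_simps)
    ultimately show ?thesis
      by (simp add: mult.commute)
  qed
  ultimately show ?thesis
    by blast
qed

section \<open>Falsified weight and the optimum\<close>

definition falsified :: "assignment \<Rightarrow> clause multiset \<Rightarrow> nat" where
  "falsified X M = size (filter_mset (falsifies X) M)"

lemma cost_unit_formula: "cost (unit_formula M) X = of_nat (falsified X M)"
proof -
  have "cost (unit_formula M) X =
      (\<Sum>C | C \<in># filter_mset (falsifies X) M. of_nat (count (filter_mset (falsifies X) M) C))"
    unfolding cost_def unit_formula_def by (intro sum.cong) auto
  then show ?thesis
    by (simp add: falsified_def size_multiset_overloaded_eq)
qed

text \<open>An assignment falsifying \<open>A\<close> falsifies exactly one of its two halves, and
  any other assignment satisfies both.\<close>

lemma split_rel_falsified: "(M, N) \<in> split_rel V \<Longrightarrow> falsified X M = falsified X N"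
  by (auto simp: split_rel_def falsified_def falsifies_def)

lemma split_equiv_falsified:
  assumes "split_equiv V t M N"
  shows "falsified X M = falsified X N"
  using assms
proof (induction t arbitrary: N)
  case (Suc t)
  then obtain L where "split_equiv V t M L" "(L, N) \<in> split_rel V \<union> (split_rel V)\<inverse>"
    by (auto simp: split_equiv_def)
  then show ?case
    using Suc.IH split_rel_falsified by fastforce
qed (simp add: split_equiv_def)

lemma not_first_at_cases:
  assumes "C \<in># not_first_at f j"
  obtains k where "k < j" "C = insert (Neg (f k)) (insert (Neg (f j)) (Pos ` f ` {..<k}))"
  using assms by (auto simp: not_first_at_def set_mset_sum)

lemma php_cases:
  assumes "C \<in># php m"
  obtains "C = {}" | i where "i \<le> m" "C = all_pos (pvar i) m"
    | i j k where "i \<le> m" "j < m" "k < i"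
      "C = insert (Neg (pvar k j)) (insert (Neg (pvar i j)) (Pos ` (\<lambda>i. pvar i j) ` {..<k}))"
proof -
  have "C = {} \<or> (\<exists>i\<le>m. C = all_pos (pvar i) m) \<or>
      (\<exists>i\<le>m. \<exists>j<m. C \<in># not_first_at (\<lambda>i. pvar i j) i)"
    using assms by (auto simp: php_def set_mset_sum split: if_splits)
  then show ?thesis
    using that by (auto elim!: not_first_at_cases)
qed

lemma php_refuted_cases:
  assumes "C \<in># php_refuted m"
  obtains "C = {}" | j where "j < m" "C = all_pos (\<lambda>i. pvar i j) (Suc m)"
    | i j k where "i \<le> m" "j < m" "k < j"
      "C = insert (Neg (pvar i k)) (insert (Neg (pvar i j)) (Pos ` pvar i ` {..<k}))"
proof -
  have "C = {} \<or> (\<exists>j<m. C = all_pos (\<lambda>i. pvar i j) (Suc m)) \<or>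
      (\<exists>i\<le>m. \<exists>j<m. C \<in># not_first_at (pvar i) j)"
    using assms by (auto simp: php_refuted_def set_mset_sum split: if_splits)
  then show ?thesis
    using that by (auto elim!: not_first_at_cases)
qed

lemma filter_replicate_mset:
  "filter_mset P (replicate_mset n x) = (if P x then replicate_mset n x else {#})"
  by (induction n) auto

text \<open>Split equivalence preserves the cost, so the optimum can be read off from
  \<open>php_refuted\<close>: its \<open>m + 1\<close> boxes are always falsified, and some
  assignment satisfies everything else.\<close>

lemma MaxSAT_php: "MaxSAT (unit_formula (php m)) = of_nat (Suc m)"
proof -
  obtain t where t: "split_equiv (4 * Suc m * Suc m) t (php m) (php_refuted m)"
    using php_split_equiv by blast
  have cost: "cost (unit_formula (php m)) X = of_nat (falsified X (php_refuted m))" for X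
    using split_equiv_falsified[OF t] by (simp add: cost_unit_formula)
  define R where "R = (\<Sum>j<m. {#all_pos (\<lambda>i. pvar i j) (Suc m)#})
    + (\<Sum>i\<le>m. \<Sum>j<m. not_first_at (pvar i) j)"
  have dec: "php_refuted m = replicate_mset (Suc m) {} + R"
    by (simp add: php_refuted_def R_def)
  have f: "falsified X (php_refuted m) = Suc m + falsified X R" for X
    by (simp add: dec falsified_def falsifies_def filter_replicate_mset)
  \<comment> \<open>Pigeon \<open>i\<close> sits in hole \<open>i\<close>. Every hole below
    \<open>m\<close> is used and no pigeon sits in two holes; pigeon \<open>m\<close> gets no actual
    hole.\<close>
  define X where "X v = (case prod_decode v of (p, h) \<Rightarrow> p = h)" for v
  have X: "X (pvar i j) \<longleftrightarrow> i = j" for i j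
    by (simp add: X_def)
  have "\<not> falsifies X C" if "C \<in># R" for C
  proof -
    have "C \<in># php_refuted m" using that by (simp add: dec)
    moreover have "C \<noteq> {}"
      using that by (auto simp: R_def set_mset_sum all_pos_def elim: not_first_at_cases)
    ultimately show ?thesis
    proof (cases rule: php_refuted_cases)
      case (2 j)
      then have "Pos (pvar j j) \<in> C" by (auto simp: all_pos_def)
      then show ?thesis using X by (force simp: falsifies_def)
    qed (use X in \<open>auto simp: falsifies_def\<close>)
  qed
  then have "set_mset (filter_mset (falsifies X) R) = {}"
    by auto
  then have "falsified X R = 0"
    by (simp add: falsified_def)
  then have "cost (unit_formula (php m)) X = of_nat (Suc m)"
    by (simp add: cost f)
  moreover have "of_nat (Suc m) \<le> cost (unit_formula (php m)) Y" for Y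
    unfolding cost f by (simp only: of_nat_le_iff le_add1)
  ultimately show ?thesis
    unfolding MaxSAT_def by (intro antisym INF_greatest) (metis INF_lower UNIV_I)+
qed

lemma is_formula_unit:
  assumes "\<And>C. C \<in># M \<Longrightarrow> C \<subseteq> literals_below V"
  shows "is_formula (unit_formula M)"
proof -
  have M: "unit_formula M C \<noteq> 0 \<longleftrightarrow> C \<in># M" for C
    by (auto simp: unit_formula_def)
  have "finite C" if "C \<in># M" for C
    using assms[OF that] finite_literals_below by (rule finite_subset)
  then show ?thesis
    by (simp add: is_formula_def M)
qed

lemma php_literals:
  assumes "C \<in># php m"
  shows "C \<subseteq> literals_below (4 * Suc m * Suc m)"
proof -
  have V: "pvar i j < 4 * Suc m * Suc m" if "i \<le> m" "j \<le> m" for i j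
    using pvar_bound that by blast
  show ?thesis
    using assms
  proof (cases rule: php_cases)
    case (2 i)
    then show ?thesis using V by (auto simp: all_pos_def literals_below_def simp del: mult_Suc mult_Suc_right)
  next
    case (3 i j k)
    then show ?thesis using V by (auto simp: literals_below_def simp del: mult_Suc mult_Suc_right)
  qed simp
qed

lemma size_sum:
  fixes M :: "'i \<Rightarrow> 'a multiset"
  shows "size (\<Sum>i\<in>I. M i) = (\<Sum>i\<in>I. size (M i))"
  by (induction I rule: infinite_finite_induct) auto

lemma size_not_first_at: "size (not_first_at f j) = j"
  by (simp add: not_first_at_def size_sum)

lemma size_php: "size (php m) \<le> 3 * Suc m ^ 3"
proof -
  have "size (php m) = m + Suc m + (\<Sum>i\<le>m. \<Sum>j<m. i)"
    by (simp add: php_def size_sum size_not_first_at)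
  also have "(\<Sum>i\<le>m. \<Sum>j<m. i) \<le> (\<Sum>i\<le>m. \<Sum>j<m. Suc m)"
    by (intro sum_mono; simp)+
  also have "\<dots> \<le> Suc m ^ 3"
    by (simp add: power3_eq_cube algebra_simps)
  finally show ?thesis
    using self_le_power[of "Suc m" 3] by linarith
qed


section \<open>Words for proofs with unit weights\<close>

lemma length_bin: "length (bin n) \<le> n"
proof (induction n rule: less_induct)
  case (less n)
  show ?case
  proof (cases "n = 0")
    case True
    then show ?thesis by (simp add: bin.simps)
  next
    case False
    then have "length (bin (n div 2)) \<le> n div 2" by (intro less.IH) auto
    moreover have "n div 2 + 1 \<le> n" using False by linarith
    ultimately show ?thesis using False by (subst bin.simps) auto
  qed
qed

lemma length_lit_word: "l \<in> literals_below V \<Longrightarrow> length (lit_word l) \<le> V"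
  by (auto simp: literals_below_def Suc_le_eq intro: le_less_trans[OF length_bin])

text \<open>Every copy of a clause is written separately with weight 1. It has at most
  \<open>2 * V\<close> literals of length at most \<open>V\<close>; the remaining 5 symbols are the
  colon, the comma and up to three for the name \<open>1/1\<close>.\<close>

lemma written_unit_formula:
  assumes \<nu>: "weight_notation \<nu>" and M: "\<And>C. C \<in># M \<Longrightarrow> C \<subseteq> literals_below V"
  shows "\<exists>fs. denotes \<nu> fs (unit_formula M) \<and> length (formula_word fs) \<le> size M * (2 * V * V + 5)"
proof -
  define one where "one = bin 1 @ [Slash] @ bin 1"
  have one: "\<nu> one = Some 1"
  proof -
    have "\<nu> (bin 1 @ [Slash] @ bin 1) = Some (ennreal (real 1 / real 1))"
      using \<nu> unfolding weight_notation_def by (metis zero_less_one)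
    then show ?thesis by (simp add: one_def)
  qed
  have len_one: "length one \<le> 3"
    using length_bin[of 1] by (simp add: one_def)
  show ?thesis
    using M
  proof (induction M)
    case empty
    show ?case
      by (intro exI[of _ "[]"]) (auto simp: denotes_def unit_formula_def formula_word_def)
  next
    case (add C M)
    then obtain fs where fs: "denotes \<nu> fs (unit_formula M)"
      "length (formula_word fs) \<le> size M * (2 * V * V + 5)"
      by auto
    have C: "C \<subseteq> literals_below V" using add.prems by simp
    then obtain ls where ls: "set ls = C" "distinct ls"
      using finite_distinct_list finite_subset finite_literals_below by metis
    have "length ls \<le> 2 * V"
      using distinct_card[OF ls(2)] ls(1) card_mono[OF finite_literals_below C] card_literals_below[of V]
      by simp
    moreover have "sum_list (map (length \<circ> lit_word) ls) \<le> sum_list (map (\<lambda>_. V) ls)"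
      using length_lit_word C ls(1) by (intro sum_list_mono) auto
    ultimately have "length (concat (map lit_word ls)) \<le> 2 * V * V"
      by (simp add: length_concat sum_list_triv) (meson le_trans mult_le_mono1)
    then have "length (formula_word ((ls, one) # fs)) \<le> size (add_mset C M) * (2 * V * V + 5)"
      using fs(2) len_one by (simp add: formula_word_def)
    moreover have "denotes \<nu> ((ls, one) # fs) (unit_formula (add_mset C M))"
      using fs(1) one ls(1) by (auto simp: denotes_def unit_formula_def fun_eq_iff)
    ultimately show ?case by blast
  qed
qed

lemma split_rel_literals:
  assumes "(M, N) \<in> split_rel V \<union> (split_rel V)\<inverse>" "\<forall>C\<in>#M. C \<subseteq> literals_below V"
  shows "(\<forall>C\<in>#N. C \<subseteq> literals_below V) \<and> size N \<le> Suc (size M)"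
proof -
  obtain R A x where "x < V" and A: "A \<subseteq> literals_below V"
    and "M = add_mset A R \<and> N = add_mset (insert (Pos x) A) (add_mset (insert (Neg x) A) R) \<or>
      N = add_mset A R \<and> M = add_mset (insert (Pos x) A) (add_mset (insert (Neg x) A) R)"
    using assms(1) by (auto simp: split_rel_def)
  moreover have "Pos x \<in> literals_below V" "Neg x \<in> literals_below V"
    using \<open>x < V\<close> by (auto simp: literals_below_def)
  ultimately show ?thesis
    using assms(2) by (elim disjE conjE) simp_all
qed

text \<open>Each split or merge adds at most one clause, so none of the \<open>Suc t\<close>
  formulas has more than \<open>size M + t\<close> clauses. The additional 1 is the
  semicolon.\<close>

lemma split_equiv_written_proof:
  assumes \<nu>: "weight_notation \<nu>" and "split_equiv V t M N"
    and M: "\<And>C. C \<in># M \<Longrightarrow> C \<subseteq> literals_below V"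
  shows "\<exists>\<pi> s. is_proof ResS \<pi> \<and> hd \<pi> = unit_formula M \<and> last \<pi> = unit_formula N \<and>
    encodes \<nu> s \<pi> \<and> length s \<le> Suc t * ((size M + t) * (2 * V * V + 5) + 1)"
proof -
  obtain g where g: "g 0 = M" "g t = N" "\<And>i. i < t \<Longrightarrow> (g i, g (Suc i)) \<in> split_rel V \<union> (split_rel V)\<inverse>"
    using assms(2) unfolding split_equiv_def relpow_fun_conv by blast
  have inv: "(\<forall>C\<in>#g i. C \<subseteq> literals_below V) \<and> size (g i) \<le> size M + i" if "i \<le> t" for i
    using that
  proof (induction i)
    case 0
    then show ?case using g(1) M by simp
  next
    case (Suc i)
    then have IH: "\<forall>C\<in>#g i. C \<subseteq> literals_below V" "size (g i) \<le> size M + i" and "i < t"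
      by simp_all
    from split_rel_literals[OF g(3)[OF this(3)] this(1)] IH(2) show ?case
      by simp
  qed
  let ?b = "(size M + t) * (2 * V * V + 5)"
  have "\<exists>fs. denotes \<nu> fs (unit_formula (g i)) \<and> length (formula_word fs) \<le> ?b" if i: "i \<le> t" for i
  proof -
    obtain fs where fs: "denotes \<nu> fs (unit_formula (g i))"
      "length (formula_word fs) \<le> size (g i) * (2 * V * V + 5)"
      using written_unit_formula[OF \<nu>, of "g i" V] inv[OF i] by blast
    have "size (g i) * (2 * V * V + 5) \<le> ?b"
      using inv[OF i] i by (intro mult_le_mono1) auto
    then show ?thesis using fs le_trans by blast
  qed
  then obtain fs where fs: "\<And>i. i \<le> t \<Longrightarrow> denotes \<nu> (fs i) (unit_formula (g i))"
    "\<And>i. i \<le> t \<Longrightarrow> length (formula_word (fs i)) \<le> ?b"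
    by metis
  define \<pi> where "\<pi> = map (\<lambda>i. unit_formula (g i)) [0..<Suc t]"
  define s where "s = proof_word (map fs [0..<Suc t])"
  have "is_proof ResS \<pi>"
    unfolding is_proof_def
  proof (intro conjI allI impI)
    fix i assume "Suc i < length \<pi>"
    then have i: "i < t" by (simp add: \<pi>_def)
    have "step ResS (unit_formula (g i)) (unit_formula (g (Suc i)))"
      using g(3)[OF i] split_step by blast
    then show "step ResS (\<pi> ! i) (\<pi> ! Suc i)"
      using i by (simp add: \<pi>_def del: upt_Suc)
  qed (simp add: \<pi>_def)
  moreover have "hd \<pi> = unit_formula M" "last \<pi> = unit_formula N"
    by (simp_all add: \<pi>_def g hd_map last_map del: upt_Suc)
  moreover have "encodes \<nu> s \<pi>"
    unfolding encodes_def s_def \<pi>_def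
    by (intro exI conjI refl)
      (use fs in \<open>auto simp: list_all2_map1 list_all2_map2 list_all2_same simp del: upt_Suc\<close>)
  moreover have "length s \<le> Suc t * (?b + 1)"
  proof -
    have "length s = (\<Sum>i\<leftarrow>[0..<Suc t]. length (formula_word (fs i)) + 1)"
      by (simp add: s_def proof_word_def length_concat comp_def del: upt_Suc)
    also have "\<dots> \<le> (\<Sum>i\<leftarrow>[0..<Suc t]. ?b + 1)"
      using fs(2) by (intro sum_list_mono) auto
    also have "\<dots> = Suc t * (?b + 1)"
      by (simp only: sum_list_triv) simp
    finally show ?thesis .
  qed
  ultimately show ?thesis by blast
qed

lemma length_formula_word: "length fs \<le> length (formula_word fs)"
  by (induction fs) (auto simp: formula_word_def)

text \<open>Every written clause takes up at least one symbol, whatever the names of the weights, so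
  a lower bound on the number of distinct clauses is one on the length of the word.\<close>

lemma card_encoded_clauses:
  assumes "encodes \<nu> s \<pi>"
  obtains \<C> where "finite \<C>" "card \<C> \<le> length s" "\<And>G C. G \<in> set \<pi> \<Longrightarrow> G C \<noteq> 0 \<Longrightarrow> C \<in> \<C>"
proof -
  obtain p where s: "s = proof_word p" and p: "list_all2 (denotes \<nu>) p \<pi>"
    using assms by (auto simp: encodes_def)
  define \<C> where "\<C> = set (map (\<lambda>(ls, a). set ls) (concat p))"
  have "length (concat p) \<le> length (proof_word p)"
  proof (induction p)
    case (Cons fs p)
    then show ?case
      using length_formula_word[of fs] by (simp add: proof_word_def)
  qed (simp add: proof_word_def)
  moreover have "card \<C> \<le> length (concat p)"
    unfolding \<C>_def by (metis card_length length_map)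
  moreover have "C \<in> \<C>" if "G \<in> set \<pi>" and C: "G C \<noteq> 0" for G C
  proof -
    obtain fs where "fs \<in> set p" "denotes \<nu> fs G"
      using p \<open>G \<in> set \<pi>\<close> by (metis list_all2_conv_all_nth in_set_conv_nth)
    then have "G = formula_of (map (\<lambda>(ls, a). (set ls, the (\<nu> a))) fs)"
      by (simp add: denotes_def)
    then have "C \<in> fst ` set (map (\<lambda>(ls, a). (set ls, the (\<nu> a))) fs)"
      using C formula_of_nonzero by blast
    then show ?thesis
      using \<open>fs \<in> set p\<close> by (force simp: \<C>_def)
  qed
  ultimately show ?thesis
    using that[of \<C>] s by (simp add: \<C>_def)
qed


section \<open>The separation\<close>

text \<open>The axiom of pigeon \<open>i\<close> is falsified only when \<open>i\<close> is the
  pigeon left out, and the hole axioms hold under all critical assignments.\<close>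

lemma missed_php:
  assumes "C \<in># php m" "C \<noteq> {}"
  shows "card (missed m \<rho> C) \<le> 1"
  using assms(1)
proof (cases rule: php_cases)
  case (2 i)
  have "missed m \<rho> C \<subseteq> {i}"
  proof
    fix i' assume "i' \<in> missed m \<rho> C"
    then obtain \<alpha> where "critical m \<rho> i' \<alpha>" and fals: "falsifies (critical_assignment m i' \<alpha>) C"
      by (auto simp: missed_def)
    then have bij: "bij_betw \<alpha> ({..m} - {i'}) {..<m}"
      by (simp add: critical_def)
    have False if "i' \<noteq> i"
    proof -
      have "\<alpha> i < m" using bij that 2(1) by (auto simp: bij_betw_def)
      then have "Pos (pvar i (\<alpha> i)) \<in> C" by (auto simp: 2 all_pos_def)
      then show False using fals that 2(1) by (force simp: falsifies_def)
    qed
    then show "i' \<in> {i}" by auto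
  qed
  then show ?thesis
    using card_mono[of "{i}"] by fastforce
next
  case (3 i j k)
  have "i' \<notin> missed m \<rho> C" for i'
  proof
    assume "i' \<in> missed m \<rho> C"
    then obtain \<alpha> where "critical m \<rho> i' \<alpha>" and fals: "falsifies (critical_assignment m i' \<alpha>) C"
      by (auto simp: missed_def)
    then have "inj_on \<alpha> ({..m} - {i'})"
      by (simp add: critical_def bij_betw_def)
    moreover have "\<alpha> k = j" "\<alpha> i = j" "k \<noteq> i'" "i \<noteq> i'"
      using fals by (auto simp: 3 falsifies_def)
    ultimately show False
      using 3(1,3) inj_onD[of \<alpha> "{..m} - {i'}" k i] by auto
  qed
  then have "missed m \<rho> C = {}" by blast
  then show ?thesis by simp
qed (use assms(2) in simp)

text \<open>For \<open>m = 0\<close> the pigeon axiom would itself be a box.\<close>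

lemma count_php_box: "0 < m \<Longrightarrow> count (php m) {} = m"
  by (auto simp: php_def count_sum all_pos_def not_first_at_def)

text \<open>The formula has \<open>m\<close> boxes and a refutation ends with weight at least
  \<open>m + 1\<close> on the box, so this weight changes. By \<open>2 \<le> u\<close>, the single
  pigeon that an axiom may miss is fewer than \<open>u\<close>.\<close>

lemma php_Res_lower_bound:
  assumes "refutation Res (unit_formula (php m)) \<pi>" "encodes \<nu> s \<pi>" "Suc m = 6 * u" "2 \<le> u"
  shows "(36 / 35) ^ (3 * u) \<le> real (length s)"
proof -
  have p: "is_proof Res \<pi>" and hd: "hd \<pi> = unit_formula (php m)"
    and sub: "subformula (formula_of [({}, of_nat (Suc m))]) (last \<pi>)"
    using assms(1) by (simp_all add: refutation_def proof_of_def MaxSAT_php del: of_nat_Suc)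
  have "formula_of [({}, of_nat (Suc m))] {} \<le> last \<pi> {}"
    using sub unfolding subformula_def by blast
  then have last: "of_nat (Suc m) \<le> last \<pi> {}"
    by (simp del: of_nat_Suc)
  obtain \<C> where \<C>: "finite \<C>" "card \<C> \<le> length s" "\<And>G C. G \<in> set \<pi> \<Longrightarrow> G C \<noteq> 0 \<Longrightarrow> C \<in> \<C>"
    using card_encoded_clauses[OF assms(2)] by blast
  have "(36 / 35) ^ (3 * u) \<le> real (card \<C>)"
  proof (rule resolution_size_lower_bound[OF p assms(3) \<C>(1)])
    show "card (missed m \<rho> C) < u" if "C \<noteq> {}" "hd \<pi> C \<noteq> 0" for \<rho> C
    proof -
      have "C \<in># php m"
        using that(2) by (auto simp: hd unit_formula_def)
      from missed_php[OF this that(1), of \<rho>] show ?thesis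
        using assms(4) by linarith
    qed
    show "last \<pi> {} \<noteq> hd \<pi> {}"
    proof
      assume "last \<pi> {} = hd \<pi> {}"
      moreover have "0 < m" using assms(3,4) by linarith
      ultimately have "of_nat (Suc m) \<le> (of_nat m :: ennreal)"
        using last by (simp add: hd unit_formula_def count_php_box)
      then show False by (simp only: of_nat_le_iff)
    qed
  qed (rule \<C>(3))
  then show ?thesis
    using \<C>(2) by linarith
qed

lemma php_ResS_upper_bound:
  assumes "weight_notation \<nu>"
  shows "\<exists>\<pi> s. refutation ResS (unit_formula (php m)) \<pi> \<and> encodes \<nu> s \<pi> \<and> length s \<le> 1300 * Suc m ^ 10"
proof -
  define n where "n = Suc m"
  let ?V = "4 * Suc m * Suc m"
  obtain t where t: "t \<le> 4 * Suc m ^ 3" "split_equiv ?V t (php m) (php_refuted m)"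
    using php_split_equiv by blast
  obtain \<pi> s where \<pi>: "is_proof ResS \<pi>" "hd \<pi> = unit_formula (php m)" "last \<pi> = unit_formula (php_refuted m)"
    "encodes \<nu> s \<pi>" and s: "length s \<le> Suc t * ((size (php m) + t) * (2 * ?V * ?V + 5) + 1)"
    using split_equiv_written_proof[OF assms t(2) php_literals] by blast
  have "Suc m \<le> count (php_refuted m) {}"
    by (simp add: php_refuted_def)
  then have "of_nat (Suc m) \<le> (of_nat (count (php_refuted m) {}) :: ennreal)"
    by (simp only: of_nat_le_iff)
  then have "subformula (formula_of [({}, MaxSAT (unit_formula (php m)))]) (last \<pi>)"
    unfolding MaxSAT_php \<pi>(3) by (simp add: subformula_def unit_formula_def del: of_nat_Suc)
  then have "refutation ResS (unit_formula (php m)) \<pi>"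
    using \<pi> by (simp add: refutation_def proof_of_def)
  moreover have "length s \<le> 1300 * Suc m ^ 10"
  proof -
    have pos: "1 \<le> n ^ k" for k by (simp add: n_def)
    \<comment> \<open>The constants: \<open>3 + 4 = 7\<close> for the number of clauses,
      \<open>32 + 5 = 37\<close> for the length of a clause, \<open>7 * 37 + 1 = 260\<close> for a
      formula, and \<open>5 * 260 = 1300\<close> in total.\<close>
    have "Suc t \<le> 5 * n ^ 3"
      using t(1) pos[of 3] by (simp add: n_def[symmetric])
    moreover have "(size (php m) + t) * (2 * ?V * ?V + 5) + 1 \<le> 260 * n ^ 7"
    proof -
      have "size (php m) + t \<le> 7 * n ^ 3"
        using t(1) size_php[of m] by (simp add: n_def)
      moreover have "2 * ?V * ?V + 5 \<le> 37 * n ^ 4"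
      proof -
        have "2 * ?V * ?V = 32 * n ^ 4"
          unfolding n_def[symmetric] by (simp add: power4_eq_xxxx)
        then show ?thesis using pos[of 4] by linarith
      qed
      ultimately have "(size (php m) + t) * (2 * ?V * ?V + 5) \<le> (7 * n ^ 3) * (37 * n ^ 4)"
        by (rule mult_le_mono)
      also have "\<dots> = 259 * n ^ 7"
        by (simp flip: power_add)
      finally show ?thesis using pos[of 7] by linarith
    qed
    ultimately have "length s \<le> (5 * n ^ 3) * (260 * n ^ 7)"
      using s by (meson le_trans mult_le_mono)
    also have "\<dots> = 1300 * n ^ 10"
      by (simp flip: power_add)
    finally show ?thesis by (simp add: n_def)
  qed
  ultimately show ?thesis
    using \<pi>(4) by blast
qed

text \<open>With \<open>c = ln r\<close>, the power \<open>r ^ u\<close> is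
  \<open>exp (c * u)\<close>, and \<open>x ^ e / exp x\<close> tends to 0. Using
  \<open>K + 1\<close> keeps the threshold defined for \<open>K = 0\<close>.\<close>

lemma power_less_exponential:
  fixes r K :: real
  assumes "1 < r" "0 \<le> K"
  shows "\<exists>u \<ge> 2. K * real u ^ e < r ^ u"
proof -
  define c where "c = ln r"
  have c: "0 < c" using assms(1) by (simp add: c_def)
  have lim: "filterlim (\<lambda>u. c * real u) at_top sequentially"
    using c filterlim_real_sequentially by (intro filterlim_tendsto_pos_mult_at_top[OF tendsto_const])
  have "((\<lambda>u. (c * real u) ^ e / exp (c * real u)) \<longlongrightarrow> 0) sequentially"
    by (rule filterlim_compose[OF tendsto_power_div_exp_0 lim])
  then have "\<forall>\<^sub>F u in sequentially. (c * real u) ^ e / exp (c * real u) < c ^ e / (K + 1)"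
    using c assms(2) by (intro order_tendstoD(2)) auto
  then have "\<forall>\<^sub>F u in sequentially. 2 \<le> u \<and> (c * real u) ^ e / exp (c * real u) < c ^ e / (K + 1)"
    using eventually_ge_at_top[of 2] by (rule eventually_conj[rotated])
  then obtain u where u: "2 \<le> u" "(c * real u) ^ e / exp (c * real u) < c ^ e / (K + 1)"
    using eventually_happens trivial_limit_sequentially by blast
  have "exp (c * real u) = r ^ u"
    using assms(1) by (simp add: c_def exp_of_nat_mult mult.commute)
  then have "c ^ e * real u ^ e / r ^ u < c ^ e / (K + 1)"
    using u(2) by (simp add: power_mult_distrib)
  then have "c ^ e * (real u ^ e * (K + 1)) < c ^ e * r ^ u"
    using assms by (simp add: divide_simps algebra_simps)
  then have "real u ^ e * (K + 1) < r ^ u"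
    using c by simp
  moreover have "K * real u ^ e \<le> real u ^ e * (K + 1)"
    by (simp add: algebra_simps)
  ultimately show ?thesis
    using u(1) by (intro exI[of _ u]) linarith
qed

lemma ResS_p_simulates_Res: "p_simulates \<nu> ResS Res"
proof -
  have "step ResS F F'" if "step Res F F'" for F F'
    using that unfolding step_def Res_def ResS_def by blast
  then have "refutation ResS F \<pi>" if "refutation Res F \<pi>" for F \<pi>
    using that unfolding refutation_def proof_of_def is_proof_def by blast
  then show ?thesis
    unfolding p_simulates_def using polytime_id by (intro exI[of _ "\<lambda>s. s"]) blast
qed

lemma Res_not_p_simulates_ResS:
  assumes "weight_notation \<nu>"
  shows "\<not> p_simulates \<nu> Res ResS"
proof
  assume "p_simulates \<nu> Res ResS"
  then obtain f where f: "polytime f" and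
    sim: "\<And>F \<pi> s. is_formula F \<Longrightarrow> refutation ResS F \<pi> \<Longrightarrow> encodes \<nu> s \<pi> \<Longrightarrow>
      \<exists>\<pi>'. refutation Res F \<pi>' \<and> encodes \<nu> (f s) \<pi>'"
    unfolding p_simulates_def by blast
  obtain p :: "nat poly" where p: "\<And>s. length (f s) \<le> length s + poly p (length s)"
    using polytime_length_bound[OF f] by blast
  obtain c where c: "\<And>x. poly p x \<le> c * (x + 1) ^ degree p"
    using nat_poly_bound by blast
  \<comment> \<open>A word of length at most \<open>1300 * n ^ 10\<close> is mapped to one of length
    at most \<open>K * n ^ e\<close>; 1301 absorbs the \<open>+ 1\<close> from
    \<open>nat_poly_bound\<close>.\<close>
  define e where "e = 10 + 10 * degree p"
  define K where "K = 1300 + c * 1301 ^ degree p"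
  have bound: "((36 / 35) ^ 3) ^ u \<le> real K * (6 * real u) ^ e" if u: "2 \<le> u" for u
  proof -
    define n where "n = 6 * u"
    define m where "m = n - 1"
    have m: "Suc m = n" using u by (simp add: m_def n_def)
    obtain \<pi> s where \<pi>: "refutation ResS (unit_formula (php m)) \<pi>" "encodes \<nu> s \<pi>"
      and s: "length s \<le> 1300 * n ^ 10"
      using php_ResS_upper_bound[OF assms, of m] m by auto
    obtain \<pi>' where \<pi>': "refutation Res (unit_formula (php m)) \<pi>'" "encodes \<nu> (f s) \<pi>'"
      using sim[OF is_formula_unit[OF php_literals] \<pi>] by blast
    have "((36 / 35) ^ 3) ^ u \<le> real (length (f s))"
      using php_Res_lower_bound[OF \<pi>' _ u] m by (simp add: n_def power_mult)
    also have "length (f s) \<le> K * n ^ e"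
    proof -
      have pos: "1 \<le> n ^ k" for k using u by (simp add: n_def)
      have "length s + 1 \<le> 1301 * n ^ 10"
        using s pos[of 10] by linarith
      then have "(length s + 1) ^ degree p \<le> (1301 * n ^ 10) ^ degree p"
        by (rule power_mono) simp
      also have "\<dots> = 1301 ^ degree p * n ^ (10 * degree p)"
        by (simp add: power_mult_distrib power_mult)
      finally have "poly p (length s) \<le> c * (1301 ^ degree p * n ^ (10 * degree p))"
        using c[of "length s"] by (meson le_trans mult_le_mono2)
      also have "\<dots> \<le> c * 1301 ^ degree p * n ^ e"
      proof -
        have "n ^ (10 * degree p) \<le> n ^ e"
          using u by (intro power_increasing) (auto simp: e_def n_def)
        then show ?thesis by simp
      qed
      finally have "poly p (length s) \<le> c * 1301 ^ degree p * n ^ e" .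
      moreover have "length s \<le> 1300 * n ^ e"
        using s power_increasing[of 10 e n] u by (simp add: e_def n_def)
      ultimately show ?thesis
        using p[of s] by (simp add: K_def algebra_simps)
    qed
    finally show ?thesis
      by (simp add: n_def)
  qed
  have "1 < (36 / 35 :: real) ^ 3" by (rule one_less_power) auto
  then obtain u where "2 \<le> u" "(real K * 6 ^ e) * real u ^ e < ((36 / 35) ^ 3) ^ u"
    using power_less_exponential[of "(36 / 35) ^ 3" "real K * 6 ^ e" e] by auto
  then show False
    using bound[of u] by (simp add: power_mult_distrib mult.assoc)
qed

theorem theorem6:
  fixes \<nu> :: notation_map
  assumes "weight_notation \<nu>"
  shows "stronger \<nu> ResS Res"
  unfolding stronger_def
  using ResS_p_simulates_Res Res_not_p_simulates_ResS[OF assms] by blast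

end
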